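(* Let $f(x)=\mathbb{E}_{\xi\sim D}f_\xi(x)$ on $\mathbb{R}^d$ and suppose that Assumptions (Smoothness), (Bounded variance) and (Bounded stochastic gradients) of the context hold. Let $f$ have minimal value $f^*$. Regard $d,f,x_0,L,\sigma^2,G,\epsilon,\beta_1,\beta_2$ as fixed. Let the base learning rate and neighborhood size of the AdaSAM algorithm of the context be chosen, depending on the mini-batch size $b\ge1$ and number of iterations $T\ge1$, of order $\gamma\asymp\sqrt{b/T}$ and $\rho=O(\sqrt{1/(bT)})$, i.e. $c_1\sqrt{b/T}\le\gamma\le c_2\sqrt{b/T}$ and $0\le\rho\le c_3\sqrt{1/(bT)}$ for fixed constants $c_1,c_2,c_3>0$, and let $\gamma\le\frac{\epsilon}{16L}$. Then the iterates satisfy $$\frac1T\sum_{t=0}^{T-1}\mathbb{E}\|\nabla f(x_t)\|_2^2=O\Big(\frac1{\sqrt{bT}}\Big)+O\Big(\frac1{bT}\Big)+O\Big(\frac1T\Big)+O\Big(\frac1{b^{1/2}T^{3/2}}\Big)+O\Big(\frac{b^{1/2}}{T^{3/2}}\Big)+O\Big(\frac bT\Big),$$ with implied constants independent of $b$ and $T$. Moreover, when $T$ is sufficiently large (depending on $b$), $$\frac1T\sum_{t=0}^{T-1}\mathbb{E}\|\nabla f(x_t)\|_2^2=O\Big(\frac1{\sqrt{bT}}\Big),$$ with implied constant independent of $b$ and $T$.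
   Context: Problem: minimize $f(x)=\mathbb{E}_{\xi\sim D}f_\xi(x)$ over $x\in\mathbb{R}^d$, where each $f_\xi:\mathbb{R}^d\to\mathbb{R}$ is differentiable and possibly non-convex (the finite sum $f=\frac1N\sum_{i=1}^N f_{\xi_i}$ is a special case). $\|\cdot\|$ is the Euclidean norm; $\odot$ is the entrywise (Hadamard) product; squares $[\cdot]^2$, square roots, reciprocals and maxima of vectors are entrywise. Assumptions. (Smoothness) For every $\xi$ and all $x,y$: $\|\nabla f_\xi(x)-\nabla f_\xi(y)\|\le L\|x-y\|$ and $\|\nabla f(x)-\nabla f(y)\|\le L\|x-y\|$, with $L>0$. (Bounded variance) For all $x$: $\mathbb{E}_{\xi}\nabla f_\xi(x)=\nabla f(x)$ and $\mathbb{E}_\xi\|\nabla f_\xi(x)-\nabla f(x)\|^2\le\sigma^2$; for a mini-batch $B$ of size $b$ and $f_B=\frac1b\sum_{\xi\in B}f_\xi$, $\mathbb{E}\|\nabla f_B(x)-\nabla f(x)\|^2\le\sigma^2/b$. (Bounded stochastic gradients) $\|\nabla f_\xi(x)\|_\infty\le G$ for all $\xi,x$. AdaSAM. Parameters: $\gamma>0$ (base learning rate), $\rho\ge0$ (neighborhood size), $\beta_1\in[0,1)$, $\beta_2\in[0,1]$, $\epsilon>0$ small, with $\epsilon\le G$. Deterministic initial point $x_0\in\mathbb{R}^d$; $m_{-1}=0$, $v_{-1}=0$, and $\hat v_{-1}$ is the vector with all entries $\epsilon^2$. For $t=0,1,2,\dots$: draw a fresh mini-batch $B_t$ of $b$ i.i.d.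 samples from $D$, independent of the past; set $s_t=\frac1b\sum_{\xi\in B_t}\nabla f_\xi(x_t)$; $\ \delta_t=\rho\, s_t/\|s_t\|$ (with $0/\|0\|:=0$); $\ g_t=\frac1b\sum_{\xi\in B_t}\nabla f_\xi(x_t+\delta_t)$ (same mini-batch); $\ m_t=\beta_1m_{t-1}+(1-\beta_1)g_t$; $\ v_t=\beta_2v_{t-1}+(1-\beta_2)[g_t]^2$; $\ \hat v_t=\max(\hat v_{t-1},v_t)$; $\ \eta_t=1/\sqrt{\hat v_t}$; $\ x_{t+1}=x_t-\gamma\, m_t\odot\eta_t$. $\mathbb{E}$ is expectation over all the randomness of the algorithm. *)

theory Defs
  imports "HOL-Probability.Probability"
begin

definition grad :: "('a::real_inner \<Rightarrow> real) \<Rightarrow> 'a \<Rightarrow> 'a"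
  where "grad h x = (THE u. GDERIV h x :> u)"

definition objective :: "'z measure \<Rightarrow> ('z \<Rightarrow> 'a \<Rightarrow> real) \<Rightarrow> 'a \<Rightarrow> real"
  where "objective D f x = (\<integral>\<xi>. f \<xi> x \<partial>D)"

definition lipschitz_gradient :: "real \<Rightarrow> ('a::real_inner \<Rightarrow> real) \<Rightarrow> bool"
  where "lipschitz_gradient L h \<longleftrightarrow>
    (\<forall>x. h differentiable (at x)) \<and>
    (\<forall>x y. norm (grad h x - grad h y) \<le> L * norm (x - y))"

definition smoothness :: "'z measure \<Rightarrow> ('z \<Rightarrow> 'a::real_inner \<Rightarrow> real) \<Rightarrow> real \<Rightarrow> bool"
  where "smoothness D f L \<longleftrightarrow>
    0 < L \<and> (\<forall>\<xi>\<in>space D. lipschitz_gradient L (f \<xi>)) \<and> lipschitz_gradient L (objective D f)"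

(* A mini-batch of size b is given by its samples z 0, ..., z (b - 1). *)
definition minibatch_grad ::
    "('z \<Rightarrow> 'a::real_inner \<Rightarrow> real) \<Rightarrow> nat \<Rightarrow> (nat \<Rightarrow> 'z) \<Rightarrow> 'a \<Rightarrow> 'a"
  where "minibatch_grad f b z x = (1 / real b) *\<^sub>R (\<Sum>i<b. grad (f (z i)) x)"

(* The integrability clauses ensure that no integral gets the default value 0. The last clause is
   over b independent samples from D. *)
definition bounded_variance :: "'z measure \<Rightarrow> ('z \<Rightarrow> 'a::euclidean_space \<Rightarrow> real) \<Rightarrow> real \<Rightarrow> bool"
  where "bounded_variance D f \<sigma> \<longleftrightarrow>
    (\<forall>x. has_bochner_integral D (\<lambda>\<xi>. grad (f \<xi>) x) (grad (objective D f) x)) \<and>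
    (\<forall>x. integrable D (\<lambda>\<xi>. (norm (grad (f \<xi>) x - grad (objective D f) x))\<^sup>2) \<and>
         (\<integral>\<xi>. (norm (grad (f \<xi>) x - grad (objective D f) x))\<^sup>2 \<partial>D) \<le> \<sigma>\<^sup>2) \<and>
    (\<forall>b\<ge>1. \<forall>x. (\<integral>z. (norm (minibatch_grad f b z x - grad (objective D f) x))\<^sup>2 \<partial>(\<Pi>\<^sub>M i\<in>{..<b}. D))
         \<le> \<sigma>\<^sup>2 / real b)"

definition bounded_stochastic_gradients ::
    "'z measure \<Rightarrow> ('z \<Rightarrow> 'a::euclidean_space \<Rightarrow> real) \<Rightarrow> real \<Rightarrow> bool"
  where "bounded_stochastic_gradients D f G \<longleftrightarrow>
    (\<forall>\<xi>\<in>space D. \<forall>x. infnorm (grad (f \<xi>) x) \<le> G)"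

(* A state consists of the iterate and the vectors m, v and v-hat of the preceding iteration.
   Multiplication on real ^ 'n is entrywise; \<rho> / 0 = 0 makes the perturbation vanish when s = 0. *)
fun adasam_step ::
    "('z \<Rightarrow> real ^ 'n \<Rightarrow> real) \<Rightarrow> nat \<Rightarrow> real \<Rightarrow> real \<Rightarrow> real \<Rightarrow> real \<Rightarrow> (nat \<Rightarrow> 'z) \<Rightarrow>
     (real ^ 'n) \<times> (real ^ 'n) \<times> (real ^ 'n) \<times> (real ^ 'n) \<Rightarrow>
     (real ^ 'n) \<times> (real ^ 'n) \<times> (real ^ 'n) \<times> (real ^ 'n)"
  where "adasam_step f b \<gamma> \<rho> \<beta>\<^sub>1 \<beta>\<^sub>2 z (x, m, v, vh) =
    (let s = minibatch_grad f b z x;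
         \<delta> = (\<rho> / norm s) *\<^sub>R s;
         g = minibatch_grad f b z (x + \<delta>);
         m' = \<beta>\<^sub>1 *\<^sub>R m + (1 - \<beta>\<^sub>1) *\<^sub>R g;
         v' = \<beta>\<^sub>2 *\<^sub>R v + (1 - \<beta>\<^sub>2) *\<^sub>R (g * g);
         vh' = (\<chi> i. max (vh $ i) (v' $ i));
         \<eta> = (\<chi> i. 1 / sqrt (vh' $ i))
     in (x - \<gamma> *\<^sub>R (m' * \<eta>), m', v', vh'))"

(* The argument z lists the drawn samples: z t i is the i-th sample of the mini-batch of iteration t. *)
primrec adasam_state ::
    "('z \<Rightarrow> real ^ 'n \<Rightarrow> real) \<Rightarrow> real ^ 'n \<Rightarrow> nat \<Rightarrow> real \<Rightarrow> real \<Rightarrow> real \<Rightarrow> real \<Rightarrow> real \<Rightarrow>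
     (nat \<Rightarrow> nat \<Rightarrow> 'z) \<Rightarrow> nat \<Rightarrow> (real ^ 'n) \<times> (real ^ 'n) \<times> (real ^ 'n) \<times> (real ^ 'n)"
  where
    "adasam_state f x0 b \<gamma> \<rho> \<beta>\<^sub>1 \<beta>\<^sub>2 \<epsilon> z 0 = (x0, 0, 0, (\<chi> i. \<epsilon>\<^sup>2))"
  | "adasam_state f x0 b \<gamma> \<rho> \<beta>\<^sub>1 \<beta>\<^sub>2 \<epsilon> z (Suc t) =
       adasam_step f b \<gamma> \<rho> \<beta>\<^sub>1 \<beta>\<^sub>2 (z t) (adasam_state f x0 b \<gamma> \<rho> \<beta>\<^sub>1 \<beta>\<^sub>2 \<epsilon> z t)"

definition adasam ::
    "('z \<Rightarrow> real ^ 'n \<Rightarrow> real) \<Rightarrow> real ^ 'n \<Rightarrow> nat \<Rightarrow> real \<Rightarrow> real \<Rightarrow> real \<Rightarrow> real \<Rightarrow> real \<Rightarrow>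
     (nat \<Rightarrow> nat \<Rightarrow> 'z) \<Rightarrow> nat \<Rightarrow> real ^ 'n"
  where "adasam f x0 b \<gamma> \<rho> \<beta>\<^sub>1 \<beta>\<^sub>2 \<epsilon> z t = fst (adasam_state f x0 b \<gamma> \<rho> \<beta>\<^sub>1 \<beta>\<^sub>2 \<epsilon> z t)"

definition iid_minibatches ::
    "'w measure \<Rightarrow> 'z measure \<Rightarrow> nat \<Rightarrow> (nat \<Rightarrow> nat \<Rightarrow> 'w \<Rightarrow> 'z) \<Rightarrow> bool"
  where "iid_minibatches M D b X \<longleftrightarrow>
    prob_space M \<and>
    prob_space.indep_vars M (\<lambda>_. D) (\<lambda>(t, i). X t i) (UNIV \<times> {..<b}) \<and>
    (\<forall>t. \<forall>i<b. distr M D (X t i) = D)"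

definition mean_sq_grad ::
    "'w measure \<Rightarrow> (nat \<Rightarrow> nat \<Rightarrow> 'w \<Rightarrow> 'z) \<Rightarrow> 'z measure \<Rightarrow> ('z \<Rightarrow> real ^ 'n \<Rightarrow> real) \<Rightarrow> real ^ 'n \<Rightarrow>
     nat \<Rightarrow> real \<Rightarrow> real \<Rightarrow> real \<Rightarrow> real \<Rightarrow> real \<Rightarrow> nat \<Rightarrow> real"
  where "mean_sq_grad M X D f x0 b \<gamma> \<rho> \<beta>\<^sub>1 \<beta>\<^sub>2 \<epsilon> T =
    (1 / real T) * (\<Sum>t<T. \<integral>\<omega>. (norm (grad (objective D f)
      (adasam f x0 b \<gamma> \<rho> \<beta>\<^sub>1 \<beta>\<^sub>2 \<epsilon> (\<lambda>t i. X t i \<omega>) t)))\<^sup>2 \<partial>M)"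

definition admissible_parameters ::
    "real \<Rightarrow> real \<Rightarrow> real \<Rightarrow> real \<Rightarrow> real \<Rightarrow> nat \<Rightarrow> nat \<Rightarrow> real \<Rightarrow> real \<Rightarrow> bool"
  where "admissible_parameters c1 c2 c3 \<epsilon> L b T \<gamma> \<rho> \<longleftrightarrow>
    c1 * sqrt (real b / real T) \<le> \<gamma> \<and> \<gamma> \<le> c2 * sqrt (real b / real T) \<and>
    0 \<le> \<rho> \<and> \<rho> \<le> c3 * sqrt (1 / (real b * real T)) \<and>
    \<gamma> \<le> \<epsilon> / (16 * L)"

end

theory Submission
  imports Defs
begin

text \<open>
  Along every sample path, \<open>p\<^sub>t = \<langle>\<nabla>f(x\<^sub>t), m\<^sub>t \<odot> \<eta>\<^sub>t\<rangle>\<close> satisfies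
  \<open>p\<^sub>t \<ge> \<beta>\<^sub>1 p\<^sub>t\<^sub>-\<^sub>1 + (1 - \<beta>\<^sub>1) \<langle>\<nabla>f(x\<^sub>t), g\<^sub>t \<odot> \<eta>\<^sub>t\<rangle>\<close> up to an error of order \<open>\<gamma>\<close> times the squared
  step direction and a multiple of the decrease of the entries of \<open>\<eta>\<close>, which telescopes since \<open>\<eta>\<close> is
  decreasing and bounded. Replacing \<open>\<eta>\<^sub>t\<close> by \<open>\<eta>\<^sub>t\<^sub>-\<^sub>1\<close> costs another telescoping term; replacing
  \<open>g\<^sub>t\<close> by \<open>s\<^sub>t\<close> costs \<open>O(\<rho>\<^sup>2)\<close> and a fraction of the squared gradient norm. As the fresh
  mini-batch is independent of \<open>(x\<^sub>t, \<eta>\<^sub>t\<^sub>-\<^sub>1)\<close> and the entries of \<open>\<eta>\<close> are at least \<open>1/G\<close>, the expectation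
  of \<open>\<langle>\<nabla>f(x\<^sub>t), s\<^sub>t \<odot> \<eta>\<^sub>t\<^sub>-\<^sub>1\<rangle>\<close> is at least that of the squared gradient norm divided by \<open>G\<close>.
  With the descent inequality this bounds the mean squared gradient by
  \<open>O(1/(\<gamma>T) + 1/T + \<rho>\<^sup>2 + \<gamma>/b)\<close> as long as \<open>\<gamma>\<close> is below a constant. Otherwise \<open>b/T\<close> is bounded below
  and the bounded gradients suffice. For \<open>T \<ge> b\<^sup>3\<close> all terms are dominated by \<open>1/sqrt(bT)\<close>.
\<close>

section \<open>Momentum with a decreasing diagonal preconditioner\<close>

text \<open>\<open>grad\<close> is a definite description, so existence and uniqueness are both
  needed. The derivative is a linear functional, represented by the vector of its values on the
  basis; the difference of two representing vectors is orthogonal to itself.\<close>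

lemma gderiv_grad:
  fixes h :: "'a::euclidean_space \<Rightarrow> real"
  assumes "h differentiable (at x)"
  shows "GDERIV h x :> grad h x"
proof -
  obtain D' where D': "(h has_derivative D') (at x)"
    using assms by (auto simp: differentiable_def)
  have lin: "linear D'"
    using D' has_derivative_linear by blast
  define u where "u = (\<Sum>i\<in>Basis. D' i *\<^sub>R i)"
  have "D' y = y \<bullet> u" for y
  proof -
    have "D' y = D' (\<Sum>i\<in>Basis. (y \<bullet> i) *\<^sub>R i)"
      by (simp add: euclidean_representation)
    also have "\<dots> = (\<Sum>i\<in>Basis. (y \<bullet> i) * D' i)"
      using lin by (simp add: linear_sum linear_scale)
    finally show ?thesis
      by (simp add: u_def inner_sum_right mult.commute)
  qed
  then have "D' = (\<lambda>y. y \<bullet> u)" ..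
  with D' have u: "GDERIV h x :> u"
    by (simp add: gderiv_def inner_commute)
  moreover have "w = u" if "GDERIV h x :> w" for w
  proof -
    have "(\<lambda>y. y \<bullet> w) = (\<lambda>y. y \<bullet> u)"
      using that u has_derivative_unique unfolding gderiv_def by blast
    then have "(w - u) \<bullet> (w - u) = 0"
      by (metis inner_diff_right right_minus_eq)
    then show ?thesis by simp
  qed
  ultimately show ?thesis
    unfolding grad_def by (rule theI)
qed

text \<open>Comes from the mean value theorem at one intermediate point of the segment, which gives
  the factor \<open>L\<close> instead of the sharp \<open>L / 2\<close>; the loss only affects
  constants.\<close>

lemma lipschitz_gradient_descent:
  fixes h :: "'a::euclidean_space \<Rightarrow> real"
  assumes "lipschitz_gradient L h" and "0 \<le> L"
  shows "h y \<le> h x + grad h x \<bullet> (y - x) + L * (norm (y - x))\<^sup>2"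
proof -
  have der: "(h has_derivative (\<lambda>v. v \<bullet> grad h u)) (at u within S)" for u S
    using gderiv_grad[of h u] assms(1)
    unfolding lipschitz_gradient_def gderiv_def by (blast intro: has_derivative_at_withinI)
  have "((\<lambda>s. h (x + s *\<^sub>R (y - x))) has_derivative
      (\<lambda>v. (v *\<^sub>R (y - x)) \<bullet> grad h (x + s *\<^sub>R (y - x)))) (at s within {0..1})" for s
    by (rule has_derivative_compose[OF _ der]) (auto intro!: derivative_eq_intros)
  then obtain s where s: "s \<in> {0..1::real}"
    and eq: "h y - h x = (y - x) \<bullet> grad h (x + s *\<^sub>R (y - x))"
    using mvt_very_simple[of 0 1 "\<lambda>s. h (x + s *\<^sub>R (y - x))"
        "\<lambda>s v. (v *\<^sub>R (y - x)) \<bullet> grad h (x + s *\<^sub>R (y - x))"] by auto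
  have "(y - x) \<bullet> (grad h (x + s *\<^sub>R (y - x)) - grad h x)
      \<le> norm (y - x) * norm (grad h (x + s *\<^sub>R (y - x)) - grad h x)"
    by (rule norm_cauchy_schwarz)
  also have "\<dots> \<le> norm (y - x) * (L * norm (x + s *\<^sub>R (y - x) - x))"
    using assms(1) unfolding lipschitz_gradient_def by (intro mult_left_mono) (blast, simp)
  also have "\<dots> \<le> norm (y - x) * (L * norm (y - x))"
    using s assms(2) by (intro mult_left_mono) (auto simp: mult_left_le_one_le)
  finally show ?thesis
    using eq by (simp add: inner_diff_right inner_commute power2_eq_square algebra_simps)
qed

section \<open>Entrywise products and elementary norm inequalities\<close>

lemma inner_mult_vec:
  fixes u v w :: "real ^ 'n"
  shows "u \<bullet> (v * w) = (\<Sum>i\<in>UNIV. u $ i * v $ i * w $ i)"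
  by (simp add: inner_vec_def mult.assoc)

text \<open>The weights \<open>W i\<close> stay separate for each coordinate: with \<open>W\<close>
  the entrywise decrease of the preconditioner, the bounds telescope over time.\<close>

lemma abs_inner_mult_le:
  fixes u v w :: "real ^ 'n"
  assumes "\<And>i. \<bar>u $ i\<bar> \<le> G" and "\<And>i. \<bar>v $ i\<bar> \<le> G" and "\<And>i. \<bar>w $ i\<bar> \<le> W i"
  shows "\<bar>u \<bullet> (v * w)\<bar> \<le> G\<^sup>2 * (\<Sum>i\<in>UNIV. W i)"
proof -
  have "\<bar>u \<bullet> (v * w)\<bar> \<le> (\<Sum>i\<in>UNIV. \<bar>u $ i * v $ i * w $ i\<bar>)"
    unfolding inner_mult_vec by (rule sum_abs)
  also have "\<dots> \<le> (\<Sum>i\<in>UNIV. G * G * W i)"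
  proof (rule sum_mono)
    fix i
    have "0 \<le> G" using assms(1)[of i] by linarith
    then show "\<bar>u $ i * v $ i * w $ i\<bar> \<le> G * G * W i"
      using assms[of i] unfolding abs_mult by (intro mult_mono) auto
  qed
  finally show ?thesis
    by (simp add: sum_distrib_left power2_eq_square)
qed

lemma norm_mult_vec_le:
  fixes v w :: "real ^ 'n"
  assumes "\<And>i. \<bar>w $ i\<bar> \<le> c" and "0 \<le> c"
  shows "norm (v * w) \<le> c * norm v"
proof -
  have "norm (v * w) \<le> norm (c *\<^sub>R v)"
    using assms by (intro norm_le_componentwise_cart)
      (simp add: abs_mult mult.commute[of c] mult_left_mono)
  then show ?thesis using assms(2) by simp
qed

text \<open>The gap between the two sides is exactly \<open>\<beta> * (1 - \<beta>)\<close> times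
  the squared distance of \<open>u\<close> and \<open>v\<close>. Serves as the one-step estimate for
  the momentum average.\<close>

lemma norm_convex_sq:
  fixes u v :: "'a::real_inner"
  assumes "0 \<le> \<beta>" and "\<beta> \<le> 1"
  shows "(norm (\<beta> *\<^sub>R u + (1 - \<beta>) *\<^sub>R v))\<^sup>2 \<le> \<beta> * (norm u)\<^sup>2 + (1 - \<beta>) * (norm v)\<^sup>2"
proof -
  have "\<beta> * (norm u)\<^sup>2 + (1 - \<beta>) * (norm v)\<^sup>2 - (norm (\<beta> *\<^sub>R u + (1 - \<beta>) *\<^sub>R v))\<^sup>2
      = \<beta> * (1 - \<beta>) * (norm (u - v))\<^sup>2"
    unfolding power2_norm_eq_inner
    by (simp add: inner_simps inner_commute algebra_simps power2_eq_square)
  also have "\<dots> \<ge> 0" using assms by simp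
  finally show ?thesis by simp
qed

lemma norm_sum3_sq:
  fixes u v w :: "'a::real_normed_vector"
  shows "(norm (u + v + w))\<^sup>2 \<le> 3 * ((norm u)\<^sup>2 + (norm v)\<^sup>2 + (norm w)\<^sup>2)"
proof -
  have "norm (u + v + w) \<le> norm u + norm v + norm w"
    by (meson add_right_mono norm_triangle_ineq order_trans)
  then have "(norm (u + v + w))\<^sup>2 \<le> (norm u + norm v + norm w)\<^sup>2"
    by (intro power_mono) auto
  \<comment> \<open>The right side exceeds the left by the sum of the squares of the three pairwise
    differences.\<close>
  also have "\<dots> \<le> 3 * ((norm u)\<^sup>2 + (norm v)\<^sup>2 + (norm w)\<^sup>2)"
    using sum_squares_ge_zero[of "norm u - norm v" "norm v - norm w"]
      zero_le_power2[of "norm u - norm w"]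
    by (simp add: power2_eq_square algebra_simps)
  finally show ?thesis .
qed

text \<open>Momentum and preconditioner are shifted by one: \<open>m t\<close> and \<open>h t\<close> stand for \<open>m\<^sub>t\<^sub>-\<^sub>1\<close> and
  \<open>\<eta>\<^sub>t\<^sub>-\<^sub>1\<close>.\<close>
lemma preconditioned_momentum_bound:
  fixes F :: "real ^ 'n \<Rightarrow> real" and x m g s h :: "nat \<Rightarrow> real ^ 'n"
  assumes smooth: "lipschitz_gradient L F" and "0 < L"
    and gradF: "\<And>x i. \<bar>grad F x $ i\<bar> \<le> G" and "0 < G"
    and lower: "\<And>x. fstar \<le> F x"
    and \<beta>: "0 \<le> \<beta>" "\<beta> < 1" and "0 < \<gamma>" and "0 < \<epsilon>" and "0 \<le> \<rho>"
    and m0: "m 0 = 0" and m: "\<And>t. m (Suc t) = \<beta> *\<^sub>R m t + (1 - \<beta>) *\<^sub>R g t"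
    and g: "\<And>t i. \<bar>g t $ i\<bar> \<le> G"
    and h0: "\<And>t i. 0 \<le> h t $ i" and h\<epsilon>: "\<And>t i. h t $ i \<le> 1 / \<epsilon>"
    and h_dec: "\<And>t i. h (Suc t) $ i \<le> h t $ i"
    and x: "\<And>t. x (Suc t) = x t - \<gamma> *\<^sub>R (m (Suc t) * h (Suc t))"
    and gs: "\<And>t. norm (g t - s t) \<le> L * \<rho>"
  shows "(\<Sum>t<T. grad F (x t) \<bullet> (s t * h t))
    \<le> (F (x 0) - fstar) / \<gamma> + (1 + 2 / (1 - \<beta>)) * (real CARD('n) * G\<^sup>2 / \<epsilon>)
      + (\<Sum>t<T. (norm (grad F (x t)))\<^sup>2) / (2 * G) + real T * (G * L\<^sup>2 * \<rho>\<^sup>2 / (2 * \<epsilon>\<^sup>2))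
      + (3 * L * (1 + 1 / (1 - \<beta>)) / \<epsilon>\<^sup>2) * \<gamma> *
        (real T * (L\<^sup>2 * \<rho>\<^sup>2) + (\<Sum>t<T. (norm (s t - grad F (x t)))\<^sup>2)
          + (\<Sum>t<T. (norm (grad F (x t)))\<^sup>2))"
proof -
  define A where "A t = m t * h t" for t
  \<comment> \<open>By the index shift, \<open>q (Suc t)\<close> pairs the gradient at
    \<open>x t\<close> with the direction of the step leaving \<open>x t\<close>, the first-order
    term of the descent inequality.\<close>
  define q where "q t = grad F (x (t - 1)) \<bullet> A t" for t
  define Q where "Q t = grad F (x t) \<bullet> (g t * h (Suc t))" for t
  define \<Delta> where "\<Delta> t = (\<Sum>i\<in>UNIV. h t $ i - h (Suc t) $ i)" for t
  define S where "S = (\<Sum>t<T. (norm (A (Suc t)))\<^sup>2)"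
  define K where "K = real CARD('n) * G\<^sup>2 / \<epsilon>"
  let ?N = "\<lambda>t. (norm (grad F (x t)))\<^sup>2" and ?V = "\<lambda>t. (norm (s t - grad F (x t)))\<^sup>2"
  have A0: "A 0 = 0" and q0: "q 0 = 0"
    by (simp_all add: A_def q_def m0 vec_eq_iff)
  have mb: "\<bar>m t $ i\<bar> \<le> G" for t i
  proof (induction t)
    case 0
    then show ?case using \<open>0 < G\<close> by (simp add: m0)
  next
    case (Suc t)
    have "\<bar>m (Suc t) $ i\<bar> \<le> \<beta> * \<bar>m t $ i\<bar> + (1 - \<beta>) * \<bar>g t $ i\<bar>"
      unfolding m using \<beta> by (simp add: abs_mult order_trans[OF abs_triangle_ineq])
    also have "\<dots> \<le> \<beta> * G + (1 - \<beta>) * G"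
      using \<beta> Suc.IH g[of t i] by (intro add_mono mult_left_mono) auto
    finally show ?case by (simp add: algebra_simps)
  qed
  have hb: "\<bar>h t $ i\<bar> \<le> 1 / \<epsilon>" for t i
    using h0 h\<epsilon> by simp
  have \<Delta>: "\<bar>u \<bullet> (v * (h (Suc t) - h t))\<bar> \<le> G\<^sup>2 * \<Delta> t"
    if "\<And>i. \<bar>u $ i\<bar> \<le> G" "\<And>i. \<bar>v $ i\<bar> \<le> G" for u v t
    unfolding \<Delta>_def using that h_dec by (intro abs_inner_mult_le) auto
  \<comment> \<open>Each coordinate telescopes in time, and its total decrease is at most
    \<open>1 / \<epsilon>\<close>.\<close>
  have "(\<Sum>t<T. \<Delta> t) = (\<Sum>i\<in>UNIV. h 0 $ i - h T $ i)"
    unfolding \<Delta>_def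
    using sum_lessThan_telescope'[of "\<lambda>t. h t $ i" T for i] by (subst sum.swap) simp
  also have "\<dots> \<le> (\<Sum>i\<in>(UNIV::'n set). 1 / \<epsilon>)"
    using h0 h\<epsilon> by (intro sum_mono) (smt (verit))
  finally have "G\<^sup>2 * (\<Sum>t<T. \<Delta> t) \<le> G\<^sup>2 * (real CARD('n) / \<epsilon>)"
    by (intro mult_left_mono) auto
  then have \<Delta>_sum: "G\<^sup>2 * (\<Sum>t<T. \<Delta> t) \<le> K"
    by (simp add: K_def mult.commute)
  have q_bound: "\<bar>q t\<bar> \<le> K" for t
  proof -
    have "\<bar>q t\<bar> \<le> G\<^sup>2 * (\<Sum>i\<in>(UNIV::'n set). 1 / \<epsilon>)"
      unfolding q_def A_def using gradF mb hb by (intro abs_inner_mult_le) auto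
    then show ?thesis by (simp add: K_def mult.commute)
  qed
  \<comment> \<open>Expands the momentum once. Moving the gradient from \<open>x (t - 1)\<close> to
    \<open>x t\<close> costs the Lipschitz constant times the length of the previous step; moving
    the preconditioner from \<open>h t\<close> to \<open>h (Suc t)\<close> costs
    \<open>\<Delta> t\<close>.\<close>
  have q_step: "\<beta> * q t + (1 - \<beta>) * Q t - \<gamma> * L * (norm (A t))\<^sup>2 - G\<^sup>2 * \<Delta> t \<le> q (Suc t)" for t
  proof -
    \<comment> \<open>also for \<open>t = 0\<close>, where \<open>t - 1 = 0\<close> and \<open>A 0 = 0\<close>\<close>
    have xt: "x t - x (t - 1) = - \<gamma> *\<^sub>R A t"
      by (cases t) (simp add: A0, simp add: x A_def)
    have "\<bar>(grad F (x t) - grad F (x (t - 1))) \<bullet> A t\<bar>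
        \<le> norm (grad F (x t) - grad F (x (t - 1))) * norm (A t)"
      by (rule Cauchy_Schwarz_ineq2)
    also have "\<dots> \<le> (L * norm (x t - x (t - 1))) * norm (A t)"
      using smooth unfolding lipschitz_gradient_def by (intro mult_right_mono) auto
    also have "\<dots> = \<gamma> * L * (norm (A t))\<^sup>2"
      unfolding xt using \<open>0 < \<gamma>\<close> by (simp add: power2_eq_square)
    finally have "\<beta> * \<bar>(grad F (x t) - grad F (x (t - 1))) \<bullet> A t\<bar> \<le> 1 * (\<gamma> * L * (norm (A t))\<^sup>2)"
      using \<beta> \<open>0 < \<gamma>\<close> \<open>0 < L\<close> by (intro mult_mono) auto
    moreover have "\<beta> * \<bar>grad F (x t) \<bullet> (m t * (h (Suc t) - h t))\<bar> \<le> 1 * (G\<^sup>2 * \<Delta> t)"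
      using \<beta> \<Delta>[OF gradF mb] by (intro mult_mono) auto
    moreover have "q (Suc t) = \<beta> * q t + (1 - \<beta>) * Q t
        + \<beta> * ((grad F (x t) - grad F (x (t - 1))) \<bullet> A t)
        + \<beta> * (grad F (x t) \<bullet> (m t * (h (Suc t) - h t)))"
      unfolding q_def Q_def A_def by (simp add: m algebra_simps inner_simps)
    ultimately show ?thesis
      using \<beta> abs_ge_minus_self[of "\<beta> * ((grad F (x t) - grad F (x (t - 1))) \<bullet> A t)"]
        abs_ge_minus_self[of "\<beta> * (grad F (x t) \<bullet> (m t * (h (Suc t) - h t)))"]
      by (simp add: abs_mult)
  qed
  \<comment> \<open>Since \<open>q 0 = 0\<close>, the differences
    \<open>q (Suc t) - \<beta> * q t\<close> sum to the right side.\<close>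
  have "(\<Sum>t<n. (1 - \<beta>) * Q t - \<gamma> * L * (norm (A t))\<^sup>2 - G\<^sup>2 * \<Delta> t)
      \<le> (1 - \<beta>) * (\<Sum>t<n. q (Suc t)) + \<beta> * q n" for n
  proof (induction n)
    case (Suc n)
    then show ?case using q_step[of n] by (simp add: algebra_simps)
  qed (simp add: q0)
  from this[of T] have "(1 - \<beta>) * (\<Sum>t<T. Q t)
      \<le> (1 - \<beta>) * (\<Sum>t<T. q (Suc t)) + \<beta> * q T
        + \<gamma> * L * (\<Sum>t<T. (norm (A t))\<^sup>2) + G\<^sup>2 * (\<Sum>t<T. \<Delta> t)"
    by (simp add: sum_subtractf sum_distrib_left)
  also have "\<beta> * q T \<le> 1 * K"
    using q_bound[of T] \<beta> by (smt (verit) mult_left_le_one_le mult_nonneg_nonpos)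
  also have "\<gamma> * L * (\<Sum>t<T. (norm (A t))\<^sup>2) \<le> \<gamma> * L * S"
  proof -
    have "(\<Sum>t<T. (norm (A t))\<^sup>2) \<le> (\<Sum>t<Suc T. (norm (A t))\<^sup>2)"
      by simp
    also have "\<dots> = S"
      unfolding S_def sum.lessThan_Suc_shift by (simp add: A0)
    finally show ?thesis
      using \<open>0 < \<gamma>\<close> \<open>0 < L\<close> by (intro mult_left_mono) auto
  qed
  finally have "(1 - \<beta>) * ((\<Sum>t<T. Q t) - (\<Sum>t<T. q (Suc t))) \<le> 2 * K + \<gamma> * L * S"
    using \<Delta>_sum by (simp add: algebra_simps)
  then have Q_q: "(\<Sum>t<T. Q t) \<le> (\<Sum>t<T. q (Suc t)) + (2 * K + \<gamma> * L * S) / (1 - \<beta>)"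
    using \<beta> by (simp add: field_simps)
  \<comment> \<open>The descent inequality summed along the iterates, where the values of
    \<open>F\<close> telescope.\<close>
  have "\<gamma> * (\<Sum>t<n. q (Suc t)) \<le> F (x 0) - F (x n) + L * \<gamma>\<^sup>2 * (\<Sum>t<n. (norm (A (Suc t)))\<^sup>2)" for n
  proof (induction n)
    case (Suc n)
    have "F (x (Suc n)) \<le> F (x n) - \<gamma> * q (Suc n) + L * \<gamma>\<^sup>2 * (norm (A (Suc n)))\<^sup>2"
      using lipschitz_gradient_descent[OF smooth, of "x (Suc n)" "x n"] \<open>0 < L\<close>
      by (simp add: x A_def q_def power_mult_distrib)
    then show ?case using Suc by (simp add: algebra_simps)
  qed simp
  from this[of T] lower[of "x T"] have "\<gamma> * (\<Sum>t<T. q (Suc t)) \<le> (F (x 0) - fstar) + L * \<gamma>\<^sup>2 * S"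
    by (simp add: S_def)
  then have q_sum: "(\<Sum>t<T. q (Suc t)) \<le> (F (x 0) - fstar) / \<gamma> + L * \<gamma> * S"
    using \<open>0 < \<gamma>\<close> by (simp add: field_simps power2_eq_square)
  \<comment> \<open>Momentum averaging does not increase the total squared norm. The term with
    \<open>m n\<close> lets the induction close and is dropped afterwards.\<close>
  have "(1 - \<beta>) * (\<Sum>t<n. (norm (m (Suc t)))\<^sup>2) + \<beta> * (norm (m n))\<^sup>2
      \<le> (1 - \<beta>) * (\<Sum>t<n. (norm (g t))\<^sup>2)" for n
  proof (induction n)
    case (Suc n)
    then show ?case
      using norm_convex_sq[of \<beta> "m n" "g n"] \<beta> by (simp add: m algebra_simps)
  qed (simp add: m0)
  from this[of T] \<beta> have "(1 - \<beta>) * (\<Sum>t<T. (norm (m (Suc t)))\<^sup>2) \<le> (1 - \<beta>) * (\<Sum>t<T. (norm (g t))\<^sup>2)"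
    by (smt (verit) mult_nonneg_nonneg zero_le_power2)
  then have m_sum: "(\<Sum>t<T. (norm (m (Suc t)))\<^sup>2) \<le> (\<Sum>t<T. (norm (g t))\<^sup>2)"
    using \<beta> by simp
  \<comment> \<open>Splits \<open>g t\<close> into perturbation error, sampling noise and true
    gradient.\<close>
  have g_norm: "(norm (g t))\<^sup>2 \<le> 3 * (L\<^sup>2 * \<rho>\<^sup>2 + ?V t + ?N t)" for t
  proof -
    have "(norm (g t - s t))\<^sup>2 \<le> (L * \<rho>)\<^sup>2"
      using gs by (intro power_mono) auto
    with norm_sum3_sq[of "g t - s t" "s t - grad F (x t)" "grad F (x t)"] show ?thesis
      by (simp add: power_mult_distrib)
  qed
  have "S \<le> (\<Sum>t<T. (norm (m (Suc t)))\<^sup>2 / \<epsilon>\<^sup>2)"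
    unfolding S_def
  proof (rule sum_mono)
    fix t
    have "norm (A (Suc t)) \<le> 1 / \<epsilon> * norm (m (Suc t))"
      unfolding A_def using hb \<open>0 < \<epsilon>\<close> by (intro norm_mult_vec_le) auto
    then have "(norm (A (Suc t)))\<^sup>2 \<le> (1 / \<epsilon> * norm (m (Suc t)))\<^sup>2"
      by (intro power_mono) auto
    then show "(norm (A (Suc t)))\<^sup>2 \<le> (norm (m (Suc t)))\<^sup>2 / \<epsilon>\<^sup>2"
      by (simp add: power_divide)
  qed
  also have "\<dots> \<le> (\<Sum>t<T. (norm (g t))\<^sup>2) / \<epsilon>\<^sup>2"
    unfolding sum_divide_distrib[symmetric] using m_sum by (intro divide_right_mono) auto
  also have "\<dots> \<le> (\<Sum>t<T. 3 * (L\<^sup>2 * \<rho>\<^sup>2 + ?V t + ?N t)) / \<epsilon>\<^sup>2"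
    using g_norm by (intro divide_right_mono sum_mono) auto
  also have "\<dots> = 3 / \<epsilon>\<^sup>2 * (real T * (L\<^sup>2 * \<rho>\<^sup>2) + (\<Sum>t<T. ?V t) + (\<Sum>t<T. ?N t))"
    (is "_ = _ * ?R") by (simp add: sum.distrib sum_distrib_left[symmetric])
  finally have S: "S \<le> 3 / \<epsilon>\<^sup>2 * ?R" .
  have U: "grad F (x t) \<bullet> (s t * h t)
      \<le> Q t + G\<^sup>2 * \<Delta> t + ?N t / (2 * G) + G * L\<^sup>2 * \<rho>\<^sup>2 / (2 * \<epsilon>\<^sup>2)" for t
  proof -
    let ?n = "norm (grad F (x t))" and ?r = "L * \<rho> / \<epsilon>"
    have "norm ((g t - s t) * h t) \<le> 1 / \<epsilon> * norm (g t - s t)"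
      using hb \<open>0 < \<epsilon>\<close> by (intro norm_mult_vec_le) auto
    also have "\<dots> \<le> ?r"
      using gs[of t] \<open>0 < \<epsilon>\<close> by (simp add: divide_right_mono)
    finally have "\<bar>grad F (x t) \<bullet> ((g t - s t) * h t)\<bar> \<le> ?n * ?r"
      by (meson Cauchy_Schwarz_ineq2 mult_left_mono norm_ge_zero order_trans)
    also have "\<dots> \<le> ?n\<^sup>2 / (2 * G) + G * ?r\<^sup>2 / 2"
    proof -
      \<comment> \<open>Young's inequality, weighted so that the squared gradient gets the
        coefficient \<open>1 / (2 * G)\<close>: half of the \<open>1 / G\<close> that the lower
        bound on the preconditioner will provide.\<close>
      have "0 \<le> (?n - G * ?r)\<^sup>2 / (2 * G)" using \<open>0 < G\<close> by simp
      also have "\<dots> = ?n\<^sup>2 / (2 * G) + G * ?r\<^sup>2 / 2 - ?n * ?r"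
        using \<open>0 < G\<close> \<open>0 < \<epsilon>\<close> by (simp add: power2_eq_square field_simps)
      finally show ?thesis by simp
    qed
    finally have "- (grad F (x t) \<bullet> ((g t - s t) * h t)) \<le> ?n\<^sup>2 / (2 * G) + G * L\<^sup>2 * \<rho>\<^sup>2 / (2 * \<epsilon>\<^sup>2)"
      by (simp add: power_divide power_mult_distrib abs_le_iff)
    moreover have "- (grad F (x t) \<bullet> (g t * (h (Suc t) - h t))) \<le> G\<^sup>2 * \<Delta> t"
      using \<Delta>[OF gradF g, of "x t" t t] by linarith
    moreover have "grad F (x t) \<bullet> (s t * h t)
        = Q t - grad F (x t) \<bullet> (g t * (h (Suc t) - h t)) - grad F (x t) \<bullet> ((g t - s t) * h t)"
      unfolding Q_def by (simp add: algebra_simps inner_simps)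
    ultimately show ?thesis by linarith
  qed
  have "(\<Sum>t<T. grad F (x t) \<bullet> (s t * h t))
      \<le> (\<Sum>t<T. Q t + G\<^sup>2 * \<Delta> t + ?N t / (2 * G) + G * L\<^sup>2 * \<rho>\<^sup>2 / (2 * \<epsilon>\<^sup>2))"
    by (rule sum_mono[OF U])
  also have "\<dots> = (\<Sum>t<T. Q t) + G\<^sup>2 * (\<Sum>t<T. \<Delta> t) + (\<Sum>t<T. ?N t) / (2 * G)
      + real T * (G * L\<^sup>2 * \<rho>\<^sup>2 / (2 * \<epsilon>\<^sup>2))"
    by (simp add: sum.distrib sum_distrib_left sum_divide_distrib)
  \<comment> \<open>\<open>S\<close> enters once through the descent inequality and with factor
    \<open>1 / (1 - \<beta>)\<close> through \<open>Q_q\<close>; \<open>K\<close> enters with factor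
    \<open>2 / (1 - \<beta>)\<close> through \<open>Q_q\<close> and once through
    \<open>\<Delta>_sum\<close>.\<close>
  also have "\<dots> \<le> (F (x 0) - fstar) / \<gamma> + (1 + 2 / (1 - \<beta>)) * K
      + (\<Sum>t<T. ?N t) / (2 * G) + real T * (G * L\<^sup>2 * \<rho>\<^sup>2 / (2 * \<epsilon>\<^sup>2))
      + (1 + 1 / (1 - \<beta>)) * L * \<gamma> * S"
    using Q_q q_sum \<Delta>_sum by (simp add: algebra_simps add_divide_distrib)
  also have "(1 + 1 / (1 - \<beta>)) * L * \<gamma> * S \<le> (1 + 1 / (1 - \<beta>)) * L * \<gamma> * (3 / \<epsilon>\<^sup>2 * ?R)"
    using S \<beta> \<open>0 < L\<close> \<open>0 < \<gamma>\<close> by (intro mult_left_mono) auto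
  also have "\<dots> = (3 * L * (1 + 1 / (1 - \<beta>)) / \<epsilon>\<^sup>2) * \<gamma> * ?R"
    by (simp only: times_divide_eq_left times_divide_eq_right mult_ac)
  finally show ?thesis by (simp add: K_def)
qed

section \<open>Measurability and independence\<close>

lemma borel_measurable_vecI:
  fixes f :: "'a \<Rightarrow> real ^ 'n"
  assumes "\<And>i. (\<lambda>x. f x $ i) \<in> borel_measurable M"
  shows "f \<in> borel_measurable M"
  using assms unfolding borel_measurable_euclidean_space[of f]
  by (auto simp: Basis_vec_def inner_axis)

lemma borel_measurable_vec_nth [measurable]:
  "(\<lambda>v :: real ^ 'n. v $ i) \<in> borel_measurable borel"
  by (intro borel_measurable_continuous_onI continuous_intros)

text \<open>States carry the Borel sets of the product topology, and for these the projections are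
  measurable by continuity.\<close>

lemma borel_measurable_fst_snd [measurable]:
  "(fst :: 'a::topological_space \<times> 'b::topological_space \<Rightarrow> 'a) \<in> borel_measurable borel"
  "(snd :: 'a::topological_space \<times> 'b::topological_space \<Rightarrow> 'b) \<in> borel_measurable borel"
  by (auto intro!: borel_measurable_continuous_onI continuous_intros)

text \<open>\<open>g\<close> is the pointwise limit of \<open>g\<close> evaluated at a nearby point of a countable dense set.\<close>
lemma borel_measurable_caratheodory:
  fixes g :: "'z \<Rightarrow> 'a::{metric_space, second_countable_topology} \<Rightarrow> 'b::metric_space"
  assumes meas: "\<And>x. (\<lambda>\<xi>. g \<xi> x) \<in> borel_measurable D"
    and cont: "\<And>\<xi>. \<xi> \<in> space D \<Longrightarrow> continuous_on UNIV (g \<xi>)"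
  shows "(\<lambda>(\<xi>, x). g \<xi> x) \<in> borel_measurable (D \<Otimes>\<^sub>M borel)"
proof -
  obtain C :: "'a set" where C: "countable C" "\<And>U. open U \<Longrightarrow> U \<noteq> {} \<Longrightarrow> \<exists>c\<in>C. c \<in> U"
    by (rule countable_dense_setE) blast
  then have "C \<noteq> {}" by (metis UNIV_not_empty empty_iff open_UNIV)
  define c where "c = from_nat_into C"
  have range_c: "range c = C"
    unfolding c_def using \<open>C \<noteq> {}\<close> C(1) by (rule range_from_nat_into)
  have dense: "\<exists>k. dist (c k) x < 1 / real (Suc n)" for x n
  proof -
    obtain y where "y \<in> C" "y \<in> ball x (1 / real (Suc n))"
      using C(2)[of "ball x (1 / real (Suc n))"] by auto
    moreover then obtain k where "y = c k" using range_c by auto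
    ultimately show ?thesis by (auto simp: dist_commute)
  qed
  \<comment> \<open>Taking the least suitable index makes the choice of the nearby point
    measurable.\<close>
  define k where "k n x = (LEAST j. dist (c j) x < 1 / real (Suc n))" for n x
  have k: "dist (c (k n x)) x < 1 / real (Suc n)" for n x
    unfolding k_def by (rule LeastI_ex) (rule dense)
  have k_lim: "(\<lambda>n. c (k n x)) \<longlonglongrightarrow> x" for x
  proof (rule tendsto_dist_iff[THEN iffD2], rule tendsto_sandwich[OF _ _ tendsto_const LIMSEQ_inverse_real_of_nat])
    show "\<forall>\<^sub>F n in sequentially. 0 \<le> dist (c (k n x)) x"
      by simp
    show "\<forall>\<^sub>F n in sequentially. dist (c (k n x)) x \<le> inverse (real (Suc n))"
      unfolding inverse_eq_divide by (intro always_eventually allI less_imp_le k)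
  qed
  have "(\<lambda>p. k n (snd p)) \<in> measurable (D \<Otimes>\<^sub>M borel) (count_space UNIV)" for n
    unfolding k_def by measurable
  \<comment> \<open>On each of the countably many sets where the index is constant, only the sample
    argument of \<open>g\<close> varies.\<close>
  then have "(\<lambda>p. g (fst p) (c (k n (snd p)))) \<in> borel_measurable (D \<Otimes>\<^sub>M borel)" for n
    by (rule measurable_compose_countable[rotated])
      (rule measurable_compose[OF measurable_fst meas])
  then have "(\<lambda>p. g (fst p) (snd p)) \<in> borel_measurable (D \<Otimes>\<^sub>M borel)"
  proof (rule borel_measurable_LIMSEQ_metric)
    fix p :: "'z \<times> 'a" assume "p \<in> space (D \<Otimes>\<^sub>M borel)"
    then have "isCont (g (fst p)) (snd p)"
      using cont continuous_on_eq_continuous_at[of UNIV "g (fst p)"]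
      by (auto simp: space_pair_measure)
    then show "(\<lambda>n. g (fst p) (c (k n (snd p)))) \<longlonglongrightarrow> g (fst p) (snd p)"
      using k_lim by (rule isCont_tendsto_compose)
  qed
  then show ?thesis by (simp add: case_prod_unfold)
qed

section \<open>Independence and Fubini\<close>

lemma (in prob_space) indep_var_joint_distr:
  assumes ind: "indep_var N1 X N2 Y"
    and \<phi> [measurable]: "\<phi> \<in> measurable N1 K1" and \<psi> [measurable]: "\<psi> \<in> measurable N2 K2"
  shows "distr M K1 (\<lambda>\<omega>. \<phi> (X \<omega>)) \<Otimes>\<^sub>M distr M K2 (\<lambda>\<omega>. \<psi> (Y \<omega>))
    = distr M (K1 \<Otimes>\<^sub>M K2) (\<lambda>\<omega>. (\<phi> (X \<omega>), \<psi> (Y \<omega>)))"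
proof -
  have X [measurable]: "random_variable N1 X" and Y [measurable]: "random_variable N2 Y"
    and joint: "distr M N1 X \<Otimes>\<^sub>M distr M N2 Y = distr M (N1 \<Otimes>\<^sub>M N2) (\<lambda>\<omega>. (X \<omega>, Y \<omega>))"
    using ind unfolding indep_var_distribution_eq by auto
  \<comment> \<open>\<open>pair_measure_distr\<close> asks for a sigma-finite second image law; this
    one is a probability measure.\<close>
  have "prob_space (distr M K2 (\<lambda>\<omega>. \<psi> (Y \<omega>)))" by (rule prob_space_distr) measurable
  then have "sigma_finite_measure (distr (distr M N2 Y) K2 \<psi>)"
    by (simp add: distr_distr comp_def prob_space_imp_sigma_finite)
  then have "distr (distr M N1 X) K1 \<phi> \<Otimes>\<^sub>M distr (distr M N2 Y) K2 \<psi>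
      = distr (distr M N1 X \<Otimes>\<^sub>M distr M N2 Y) (K1 \<Otimes>\<^sub>M K2) (\<lambda>(x, y). (\<phi> x, \<psi> y))"
    by (intro pair_measure_distr) auto
  then show ?thesis
    unfolding joint by (simp add: distr_distr comp_def)
qed

text \<open>Freezing: as the joint law is a product, Fubini allows averaging over \<open>Z\<close>
  with the value of \<open>S\<close> held fixed.\<close>

lemma (in prob_space) integral_independent:
  fixes h :: "'b \<times> 'c \<Rightarrow> real"
  assumes S [measurable]: "random_variable N1 S" and Z [measurable]: "random_variable N2 Z"
    and joint: "distr M N1 S \<Otimes>\<^sub>M distr M N2 Z = distr M (N1 \<Otimes>\<^sub>M N2) (\<lambda>\<omega>. (S \<omega>, Z \<omega>))"
    and h [measurable]: "h \<in> borel_measurable (N1 \<Otimes>\<^sub>M N2)"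
    and int: "integrable M (\<lambda>\<omega>. h (S \<omega>, Z \<omega>))"
  shows "integrable M (\<lambda>\<omega>. \<integral>z. h (S \<omega>, z) \<partial>distr M N2 Z)"
    and "(\<integral>\<omega>. h (S \<omega>, Z \<omega>) \<partial>M) = (\<integral>\<omega>. (\<integral>z. h (S \<omega>, z) \<partial>distr M N2 Z) \<partial>M)"
proof -
  interpret S: prob_space "distr M N1 S" by (rule prob_space_distr[OF S])
  interpret Z: prob_space "distr M N2 Z" by (rule prob_space_distr[OF Z])
  interpret P: pair_sigma_finite "distr M N1 S" "distr M N2 Z" ..
  have inth: "integrable (distr M N1 S \<Otimes>\<^sub>M distr M N2 Z) h"
    unfolding joint using int by (subst integrable_distr_eq) auto
  have m: "(\<lambda>s. \<integral>z. h (s, z) \<partial>distr M N2 Z) \<in> borel_measurable N1"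
    using Z.borel_measurable_lebesgue_integral[of "\<lambda>s z. h (s, z)" N1] by simp
  show "integrable M (\<lambda>\<omega>. \<integral>z. h (S \<omega>, z) \<partial>distr M N2 Z)"
    using P.integrable_fst'[OF inth] integrable_distr_eq[OF S m] by simp
  have "(\<integral>\<omega>. h (S \<omega>, Z \<omega>) \<partial>M) = integral\<^sup>L (distr M N1 S \<Otimes>\<^sub>M distr M N2 Z) h"
    unfolding joint by (subst integral_distr) auto
  also have "\<dots> = (\<integral>s. (\<integral>z. h (s, z) \<partial>distr M N2 Z) \<partial>distr M N1 S)"
    by (rule P.integral_fst'[symmetric, OF inth])
  also have "\<dots> = (\<integral>\<omega>. (\<integral>z. h (S \<omega>, z) \<partial>distr M N2 Z) \<partial>M)"
    by (rule integral_distr[OF S m])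
  finally show "(\<integral>\<omega>. h (S \<omega>, Z \<omega>) \<partial>M) = (\<integral>\<omega>. (\<integral>z. h (S \<omega>, z) \<partial>distr M N2 Z) \<partial>M)" .
qed

lemma norm_sq_le_card:
  fixes u :: "real ^ 'n"
  assumes "\<And>i. \<bar>u $ i\<bar> \<le> c"
  shows "(norm u)\<^sup>2 \<le> real CARD('n) * c\<^sup>2"
proof -
  have "(norm u)\<^sup>2 = (\<Sum>i\<in>UNIV. (u $ i)\<^sup>2)"
    by (simp add: norm_vec_def L2_set_def sum_nonneg)
  also have "\<dots> \<le> (\<Sum>i\<in>(UNIV::'n set). c\<^sup>2)"
    using assms by (intro sum_mono) (metis abs_ge_zero power2_abs power_mono)
  finally show ?thesis by simp
qed

text \<open>Lets the samples be restricted to the indices below \<open>b\<close>, which turns a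
  mini-batch into a point of a finite product space.\<close>

lemma minibatch_grad_cong:
  assumes "\<And>i. i < b \<Longrightarrow> z i = z' i"
  shows "minibatch_grad f b z = minibatch_grad f b z'"
  using assms by (simp add: minibatch_grad_def fun_eq_iff)

lemma adasam_step_cong:
  assumes "\<And>i. i < b \<Longrightarrow> z i = z' i"
  shows "adasam_step f b \<gamma> \<rho> \<beta>\<^sub>1 \<beta>\<^sub>2 z p = adasam_step f b \<gamma> \<rho> \<beta>\<^sub>1 \<beta>\<^sub>2 z' p"
  by (cases p) (simp add: minibatch_grad_cong[of b z z', OF assms])

text \<open>The state at time \<open>t\<close> is a function of the earlier mini-batches alone; its
  independence of mini-batch \<open>t\<close> rests on this.\<close>

lemma adasam_state_cong:
  assumes "\<And>s i. s < t \<Longrightarrow> i < b \<Longrightarrow> z s i = z' s i"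
  shows "adasam_state f x0 b \<gamma> \<rho> \<beta>\<^sub>1 \<beta>\<^sub>2 \<epsilon> z t = adasam_state f x0 b \<gamma> \<rho> \<beta>\<^sub>1 \<beta>\<^sub>2 \<epsilon> z' t"
  using assms
proof (induction t)
  case (Suc t)
  then show ?case
    using adasam_step_cong[of b "z t" "z' t"] by simp
qed simp

section \<open>Stochastic gradients under the standing assumptions\<close>

locale stochastic_objective = D: prob_space D
  for D :: "'z measure" +
  fixes f :: "'z \<Rightarrow> real ^ 'n \<Rightarrow> real" and L \<sigma> G :: real
  assumes smoothness: "smoothness D f L"
    and variance: "bounded_variance D f \<sigma>"
    and bounded: "bounded_stochastic_gradients D f G"
    and G_pos: "0 < G"
begin

abbreviation "F \<equiv> objective D f"

lemma L_pos: "0 < L"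
  using smoothness by (simp add: smoothness_def)

lemma abs_grad_nth_le:
  assumes "\<xi> \<in> space D"
  shows "\<bar>grad (f \<xi>) x $ i\<bar> \<le> G"
proof -
  have "infnorm (grad (f \<xi>) x) \<le> G"
    using bounded assms by (simp add: bounded_stochastic_gradients_def)
  then show ?thesis
    using component_le_infnorm_cart[of "grad (f \<xi>) x" i] by linarith
qed

lemma has_bochner_integral_grad:
  "has_bochner_integral D (\<lambda>\<xi>. grad (f \<xi>) x) (grad F x)"
  using variance by (simp add: bounded_variance_def)

text \<open>By unbiasedness each entry of the gradient is the mean of the entries of the stochastic
  gradients, which lie between \<open>- G\<close> and \<open>G\<close>.\<close>

lemma abs_grad_objective_nth_le: "\<bar>grad F x $ i\<bar> \<le> G"
proof -
  have "has_bochner_integral D (\<lambda>\<xi>. axis i 1 \<bullet> grad (f \<xi>) x) (axis i 1 \<bullet> grad F x)"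
    by (rule has_bochner_integral_inner_right) (rule has_bochner_integral_grad)
  then have int: "integrable D (\<lambda>\<xi>. grad (f \<xi>) x $ i)"
    and eq: "(\<integral>\<xi>. grad (f \<xi>) x $ i \<partial>D) = grad F x $ i"
    by (auto simp: inner_axis inner_commute[of "axis i 1"] has_bochner_integral_iff)
  have "(\<integral>\<xi>. grad (f \<xi>) x $ i \<partial>D) \<le> G"
    using int abs_grad_nth_le[of _ x i] by (intro D.integral_le_const AE_I2) (auto simp: abs_le_iff)
  moreover have "- G \<le> (\<integral>\<xi>. grad (f \<xi>) x $ i \<partial>D)"
    using int abs_grad_nth_le[of _ x i] by (intro D.integral_ge_const AE_I2) (fastforce simp: abs_le_iff)+
  ultimately show ?thesis by (simp add: eq)
qed

lemma abs_minibatch_grad_nth_le: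
  assumes "1 \<le> b" and "\<And>i. i < b \<Longrightarrow> z i \<in> space D"
  shows "\<bar>minibatch_grad f b z x $ j\<bar> \<le> G"
proof -
  have "\<bar>\<Sum>i<b. grad (f (z i)) x $ j\<bar> \<le> (\<Sum>i<b. G)"
    using assms abs_grad_nth_le by (intro order_trans[OF sum_abs] sum_mono) auto
  then show ?thesis
    using \<open>1 \<le> b\<close> by (simp add: minibatch_grad_def abs_mult field_simps)
qed

lemma minibatch_grad_lipschitz:
  assumes "1 \<le> b" and "\<And>i. i < b \<Longrightarrow> z i \<in> space D"
  shows "norm (minibatch_grad f b z x - minibatch_grad f b z y) \<le> L * norm (x - y)"
proof -
  have "norm (\<Sum>i<b. grad (f (z i)) x - grad (f (z i)) y) \<le> (\<Sum>i<b. L * norm (x - y))"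
    using assms smoothness unfolding smoothness_def lipschitz_gradient_def
    by (intro order_trans[OF norm_sum] sum_mono) auto
  moreover have "minibatch_grad f b z x - minibatch_grad f b z y
      = (1 / real b) *\<^sub>R (\<Sum>i<b. grad (f (z i)) x - grad (f (z i)) y)"
    by (simp add: minibatch_grad_def sum_subtractf scaleR_diff_right)
  ultimately show ?thesis
    using \<open>1 \<le> b\<close> by (simp add: field_simps)
qed

section \<open>Measurability of the gradients and of the algorithm\<close>

lemma continuous_on_lipschitz_gradient:
  assumes "lipschitz_gradient L (h :: real ^ 'n \<Rightarrow> real)"
  shows "continuous_on UNIV (grad h)"
proof (rule continuous_onI)
  fix x and e :: real assume "0 < e"
  have "dist (grad h y) (grad h x) \<le> e" if "dist y x < e / L" for y
  proof -
    have "norm (grad h y - grad h x) \<le> L * norm (y - x)"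
      using assms by (simp add: lipschitz_gradient_def)
    also have "\<dots> \<le> e" using that L_pos by (simp add: dist_norm field_simps)
    finally show ?thesis by (simp add: dist_norm)
  qed
  then show "\<exists>d>0. \<forall>y\<in>UNIV. dist y x < d \<longrightarrow> dist (grad h y) (grad h x) \<le> e"
    using \<open>0 < e\<close> L_pos by (intro exI[of _ "e / L"]) auto
qed

lemma borel_measurable_grad_objective [measurable]: "grad F \<in> borel_measurable borel"
  using smoothness by (intro borel_measurable_continuous_onI continuous_on_lipschitz_gradient)
    (simp add: smoothness_def)

text \<open>A Caratheodory function: unbiasedness includes measurability in the sample, smoothness
  gives continuity in the point.\<close>

lemma borel_measurable_grad [measurable]:
  "(\<lambda>(\<xi>, x). grad (f \<xi>) x) \<in> borel_measurable (D \<Otimes>\<^sub>M borel)"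
proof (rule borel_measurable_caratheodory)
  show "(\<lambda>\<xi>. grad (f \<xi>) x) \<in> borel_measurable D" for x
    using has_bochner_integral_grad[of x] by (rule borel_measurable_has_bochner_integral)
  show "continuous_on UNIV (grad (f \<xi>))" if "\<xi> \<in> space D" for \<xi>
    using smoothness that by (intro continuous_on_lipschitz_gradient) (simp add: smoothness_def)
qed

abbreviation batches :: "nat \<Rightarrow> (nat \<Rightarrow> 'z) measure"
  where "batches b \<equiv> \<Pi>\<^sub>M i\<in>{..<b}. D"

lemma borel_measurable_minibatch_grad [measurable]:
  assumes [measurable]: "z \<in> measurable K (batches b)" "x \<in> borel_measurable K"
  shows "(\<lambda>k. minibatch_grad f b (z k) (x k)) \<in> borel_measurable K"
proof -
  have "(\<lambda>k. grad (f (z k i)) (x k)) \<in> borel_measurable K" if "i < b" for i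
  proof -
    have "(\<lambda>k. z k i) \<in> measurable K D"
      using measurable_compose[OF assms(1) measurable_component_singleton[of i "{..<b}"]] that by simp
    then have "(\<lambda>k. (z k i, x k)) \<in> measurable K (D \<Otimes>\<^sub>M borel)"
      by measurable
    from measurable_compose[OF this borel_measurable_grad] show ?thesis by simp
  qed
  then show ?thesis unfolding minibatch_grad_def by auto
qed

lemma borel_measurable_adasam_step:
  assumes [measurable]: "z \<in> measurable K (batches b)" "x \<in> borel_measurable K"
    "m \<in> borel_measurable K" "v \<in> borel_measurable K" "w \<in> borel_measurable K"
  shows "(\<lambda>k. adasam_step f b \<gamma> \<rho> \<beta>\<^sub>1 \<beta>\<^sub>2 (z k) (x k, m k, v k, w k)) \<in> borel_measurable K"
proof -
  define s where "s k = minibatch_grad f b (z k) (x k)" for k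
  define g where "g k = minibatch_grad f b (z k) (x k + (\<rho> / norm (s k)) *\<^sub>R s k)" for k
  define v' where "v' k = \<beta>\<^sub>2 *\<^sub>R v k + (1 - \<beta>\<^sub>2) *\<^sub>R (g k * g k)" for k
  define m' where "m' k = \<beta>\<^sub>1 *\<^sub>R m k + (1 - \<beta>\<^sub>1) *\<^sub>R g k" for k
  define w' where "w' k = (\<chi> i. max (w k $ i) (v' k $ i))" for k
  define \<eta> where "\<eta> k = (\<chi> i. 1 / sqrt (w' k $ i))" for k
  have [measurable]: "s \<in> borel_measurable K"
    unfolding s_def[abs_def] by measurable
  have [measurable]: "g \<in> borel_measurable K"
    unfolding g_def[abs_def] by measurable
  have [measurable]: "m' \<in> borel_measurable K"
    unfolding m'_def[abs_def] by measurable
  have [measurable]: "(\<lambda>k. g k * g k) \<in> borel_measurable K"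
    by (rule borel_measurable_vecI) (simp add: vector_mult_component, measurable)
  have [measurable]: "v' \<in> borel_measurable K"
    unfolding v'_def[abs_def] by measurable
  have [measurable]: "w' \<in> borel_measurable K"
    by (rule borel_measurable_vecI) (simp add: w'_def, measurable)
  have [measurable]: "\<eta> \<in> borel_measurable K"
    by (rule borel_measurable_vecI) (simp add: \<eta>_def, measurable)
  have [measurable]: "(\<lambda>k. m' k * \<eta> k) \<in> borel_measurable K"
    by (rule borel_measurable_vecI) (simp add: vector_mult_component, measurable)
  have "(\<lambda>k. (x k - \<gamma> *\<^sub>R (m' k * \<eta> k), m' k, v' k, w' k)) \<in> borel_measurable K"
    by (intro borel_measurable_Pair) measurable
  then show ?thesis
    by (simp add: Let_def s_def g_def v'_def m'_def w'_def \<eta>_def)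
qed

text \<open>Only mini-batches before \<open>t\<close> are required to be measurable, so that the
  lemma also applies on the product space of the past samples.\<close>

lemma borel_measurable_adasam_state:
  assumes "\<And>s. s < t \<Longrightarrow> (\<lambda>k. \<lambda>i\<in>{..<b}. z k s i) \<in> measurable K (batches b)"
  shows "(\<lambda>k. adasam_state f x0 b \<gamma> \<rho> \<beta>\<^sub>1 \<beta>\<^sub>2 \<epsilon> (z k) t) \<in> borel_measurable K"
  using assms
proof (induction t)
  case (Suc t)
  let ?S = "\<lambda>k. adasam_state f x0 b \<gamma> \<rho> \<beta>\<^sub>1 \<beta>\<^sub>2 \<epsilon> (z k) t"
  have [measurable]: "?S \<in> borel_measurable K" using Suc by simp
  have "(\<lambda>k. adasam_step f b \<gamma> \<rho> \<beta>\<^sub>1 \<beta>\<^sub>2 (\<lambda>i\<in>{..<b}. z k t i)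
      (fst (?S k), fst (snd (?S k)), fst (snd (snd (?S k))), snd (snd (snd (?S k)))))
      \<in> borel_measurable K"
    by (rule borel_measurable_adasam_step) (use Suc.prems in measurable)
  also have "(\<lambda>k. adasam_step f b \<gamma> \<rho> \<beta>\<^sub>1 \<beta>\<^sub>2 (\<lambda>i\<in>{..<b}. z k t i)
      (fst (?S k), fst (snd (?S k)), fst (snd (snd (?S k))), snd (snd (snd (?S k)))))
      = (\<lambda>k. adasam_state f x0 b \<gamma> \<rho> \<beta>\<^sub>1 \<beta>\<^sub>2 \<epsilon> (z k) (Suc t))"
    by (simp add: fun_eq_iff adasam_step_cong[of b "\<lambda>i\<in>{..<b}. z k t i" "z k t" for k])
  finally show ?case .
qed simp

text \<open>Linearity of the integral, as each coordinate of the product measure has law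
  \<open>D\<close>.\<close>

lemma has_bochner_integral_minibatch_grad:
  assumes "1 \<le> b"
  shows "has_bochner_integral (batches b) (\<lambda>z. minibatch_grad f b z x) (grad F x)"
proof -
  have meas: "(\<lambda>\<xi>. grad (f \<xi>) x) \<in> borel_measurable D"
    using has_bochner_integral_grad by (rule borel_measurable_has_bochner_integral)
  have "has_bochner_integral (batches b) (\<lambda>z. grad (f (z i)) x) (grad F x)" if "i < b" for i
  proof -
    have comp: "(\<lambda>z. z i) \<in> measurable (batches b) D"
      using that by simp
    have "distr (batches b) D (\<lambda>z. z i) = D"
      using that by (intro distr_PiM_component) (auto intro: D.prob_space_axioms)
    then show ?thesis
      using has_bochner_integral_grad[of x] integrable_distr_eq[OF comp meas] integral_distr[OF comp meas]
      by (simp add: has_bochner_integral_iff)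
  qed
  then have "has_bochner_integral (batches b) (\<lambda>z. (1 / real b) *\<^sub>R (\<Sum>i<b. grad (f (z i)) x))
      ((1 / real b) *\<^sub>R (\<Sum>i<b. grad F x))"
    by (intro has_bochner_integral_scaleR_right has_bochner_integral_sum) auto
  moreover have "(1 / real b) *\<^sub>R (\<Sum>i<b. grad F x) = grad F x"
    using \<open>1 \<le> b\<close> by (simp add: sum_constant_scaleR del: sum_constant)
  ultimately show ?thesis by (simp add: minibatch_grad_def)
qed

end

section \<open>The AdaSAM recursion\<close>

text \<open>Read off the state before step \<open>t\<close>, this is \<eta> with index t - 1; at
  time 0 its entries are \<open>1 / \<epsilon>\<close> for positive
  \<open>\<epsilon>\<close>.\<close>

definition preconditioner :: "'a \<times> 'b \<times> 'c \<times> (real ^ 'n) \<Rightarrow> real ^ 'n"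
  where "preconditioner p = (\<chi> i. 1 / sqrt (snd (snd (snd p)) $ i))"

lemma borel_measurable_preconditioner [measurable]:
  "(preconditioner :: 'a::topological_space \<times> 'b::topological_space \<times> 'c::topological_space \<times> (real ^ 'n) \<Rightarrow> _)
    \<in> borel_measurable borel"
  by (rule borel_measurable_vecI) (simp add: preconditioner_def, measurable)

locale adasam_setup = stochastic_objective D f L \<sigma> G
  for D :: "'z measure" and f :: "'z \<Rightarrow> real ^ 'n \<Rightarrow> real" and L \<sigma> G :: real +
  fixes x0 :: "real ^ 'n" and b :: nat and \<gamma> \<rho> \<beta>\<^sub>1 \<beta>\<^sub>2 \<epsilon> fstar :: real
  assumes b_pos: "1 \<le> b" and \<gamma>_pos: "0 < \<gamma>" and \<rho>_nonneg: "0 \<le> \<rho>"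
    and \<beta>\<^sub>1_bounds: "0 \<le> \<beta>\<^sub>1" "\<beta>\<^sub>1 < 1" and \<beta>\<^sub>2_bounds: "0 \<le> \<beta>\<^sub>2" "\<beta>\<^sub>2 \<le> 1"
    and \<epsilon>_bounds: "0 < \<epsilon>" "\<epsilon> \<le> G"
    and lower_bound: "\<And>x. fstar \<le> F x"
begin

text \<open>The factor that \<open>preconditioned_momentum_bound\<close> puts, together with
  \<open>\<gamma>\<close>, before the perturbation, variance and gradient sums.\<close>

definition "noise_factor = 3 * L * (1 + 1 / (1 - \<beta>\<^sub>1)) / \<epsilon>\<^sup>2"

lemma noise_factor_pos: "0 < noise_factor"
  using L_pos \<beta>\<^sub>1_bounds \<epsilon>_bounds by (simp add: noise_factor_def add_pos_nonneg)

abbreviation "state \<equiv> adasam_state f x0 b \<gamma> \<rho> \<beta>\<^sub>1 \<beta>\<^sub>2 \<epsilon>"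

text \<open>These are the vectors s and g of iteration \<open>t\<close>: the same mini-batch,
  evaluated at the iterate and at the perturbed point.\<close>

definition "batch_grad z t = minibatch_grad f b (z t) (fst (state z t))"
definition "sam_grad z t = minibatch_grad f b (z t)
  (fst (state z t) + (\<rho> / norm (batch_grad z t)) *\<^sub>R batch_grad z t)"

section \<open>Bounds along a fixed sample path\<close>

context
  fixes z :: "nat \<Rightarrow> nat \<Rightarrow> 'z"
  assumes z: "\<And>t i. i < b \<Longrightarrow> z t i \<in> space D"
begin

abbreviation "iterate t \<equiv> fst (state z t)"
abbreviation "momentum t \<equiv> fst (snd (state z t))"
abbreviation "second_moment t \<equiv> fst (snd (snd (state z t)))"
abbreviation "max_second_moment t \<equiv> snd (snd (snd (state z t)))"

lemma momentum_Suc: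
  "momentum (Suc t) = \<beta>\<^sub>1 *\<^sub>R momentum t + (1 - \<beta>\<^sub>1) *\<^sub>R sam_grad z t"
  by (cases "state z t") (simp add: Let_def sam_grad_def batch_grad_def)

lemma second_moment_Suc:
  "second_moment (Suc t) = \<beta>\<^sub>2 *\<^sub>R second_moment t + (1 - \<beta>\<^sub>2) *\<^sub>R (sam_grad z t * sam_grad z t)"
  by (cases "state z t") (simp add: Let_def sam_grad_def batch_grad_def)

lemma max_second_moment_Suc:
  "max_second_moment (Suc t) $ i = max (max_second_moment t $ i) (second_moment (Suc t) $ i)"
  by (cases "state z t") (simp add: Let_def)

lemma iterate_Suc:
  "iterate (Suc t) = iterate t - \<gamma> *\<^sub>R (momentum (Suc t) * preconditioner (state z (Suc t)))"
  by (cases "state z t") (simp add: Let_def preconditioner_def)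

lemma abs_sam_grad_nth_le: "\<bar>sam_grad z t $ i\<bar> \<le> G"
  unfolding sam_grad_def using b_pos z by (rule abs_minibatch_grad_nth_le)

lemma second_moment_nth_le: "second_moment t $ i \<le> G\<^sup>2"
proof (induction t)
  case (Suc t)
  have "sam_grad z t $ i * sam_grad z t $ i \<le> G\<^sup>2"
    using abs_sam_grad_nth_le[of t i] by (metis abs_ge_zero power2_abs power2_eq_square power_mono)
  then have "\<beta>\<^sub>2 * second_moment t $ i + (1 - \<beta>\<^sub>2) * (sam_grad z t $ i * sam_grad z t $ i)
      \<le> \<beta>\<^sub>2 * G\<^sup>2 + (1 - \<beta>\<^sub>2) * G\<^sup>2"
    using Suc \<beta>\<^sub>2_bounds by (intro add_mono mult_left_mono) auto
  then show ?case unfolding second_moment_Suc by (simp add: algebra_simps)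
qed simp

text \<open>The running maximum starts at \<open>\<epsilon>\<^sup>2\<close>, which is at most
  \<open>G\<^sup>2\<close> by \<open>\<epsilon> \<le> G\<close>, and every second moment entering it
  is at most \<open>G\<^sup>2\<close>.\<close>

lemma max_second_moment_bounds:
  "\<epsilon>\<^sup>2 \<le> max_second_moment t $ i" "max_second_moment t $ i \<le> G\<^sup>2"
proof (induction t)
  case 0
  show "\<epsilon>\<^sup>2 \<le> max_second_moment 0 $ i" "max_second_moment 0 $ i \<le> G\<^sup>2"
    using \<epsilon>_bounds by (auto intro: power_mono)
next
  case (Suc t)
  then show "\<epsilon>\<^sup>2 \<le> max_second_moment (Suc t) $ i" "max_second_moment (Suc t) $ i \<le> G\<^sup>2"
    using second_moment_nth_le[of "Suc t" i] unfolding max_second_moment_Suc by auto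
qed

lemma sqrt_max_second_moment_bounds:
  "\<epsilon> \<le> sqrt (max_second_moment t $ i)" "sqrt (max_second_moment t $ i) \<le> G"
  using max_second_moment_bounds[of t i] \<epsilon>_bounds
  by (auto intro: real_le_rsqrt real_le_lsqrt)

lemma preconditioner_bounds:
  "1 / G \<le> preconditioner (state z t) $ i" "preconditioner (state z t) $ i \<le> 1 / \<epsilon>"
  using sqrt_max_second_moment_bounds[of t i] \<epsilon>_bounds
  unfolding preconditioner_def vec_lambda_beta by (intro divide_left_mono mult_pos_pos; linarith)+

lemma preconditioner_nonneg: "0 \<le> preconditioner (state z t) $ i"
  using preconditioner_bounds(1)[of t i] G_pos by (meson divide_pos_pos less_eq_real_def order_trans zero_less_one)

lemma preconditioner_decreasing: "preconditioner (state z (Suc t)) $ i \<le> preconditioner (state z t) $ i"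
proof -
  have "sqrt (max_second_moment t $ i) \<le> sqrt (max_second_moment (Suc t) $ i)"
    unfolding max_second_moment_Suc by simp
  then have "1 / sqrt (max_second_moment (Suc t) $ i) \<le> 1 / sqrt (max_second_moment t $ i)"
    using sqrt_max_second_moment_bounds[of t i] sqrt_max_second_moment_bounds[of "Suc t" i] \<epsilon>_bounds
    by (intro divide_left_mono mult_pos_pos) linarith+
  then show ?thesis unfolding preconditioner_def vec_lambda_beta .
qed

text \<open>The perturbation has norm at most \<open>\<rho>\<close>, also for a vanishing gradient,
  and the mini-batch gradient is Lipschitz.\<close>

lemma sam_grad_perturbation: "norm (sam_grad z t - batch_grad z t) \<le> L * \<rho>"
proof -
  have "norm (sam_grad z t - batch_grad z t) \<le> L * norm ((\<rho> / norm (batch_grad z t)) *\<^sub>R batch_grad z t)"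
    using minibatch_grad_lipschitz[of b "z t", OF b_pos z, of "iterate t + (\<rho> / norm (batch_grad z t)) *\<^sub>R batch_grad z t" "iterate t"]
    by (simp add: sam_grad_def batch_grad_def)
  also have "\<dots> \<le> L * \<rho>"
    using L_pos \<rho>_nonneg by (intro mult_left_mono) auto
  finally show ?thesis .
qed

text \<open>The preconditioner on the left belongs to the state before step \<open>t\<close>, so
  mini-batch \<open>t\<close> enters each summand only through \<open>batch_grad\<close>. This
  prepares the averaging.\<close>

lemma path_bound:
  "(\<Sum>t<T. grad F (iterate t) \<bullet> (batch_grad z t * preconditioner (state z t)))
    \<le> (F x0 - fstar) / \<gamma> + (1 + 2 / (1 - \<beta>\<^sub>1)) * (real CARD('n) * G\<^sup>2 / \<epsilon>)
      + (\<Sum>t<T. (norm (grad F (iterate t)))\<^sup>2) / (2 * G) + real T * (G * L\<^sup>2 * \<rho>\<^sup>2 / (2 * \<epsilon>\<^sup>2))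
      + noise_factor * \<gamma> *
        (real T * (L\<^sup>2 * \<rho>\<^sup>2) + (\<Sum>t<T. (norm (batch_grad z t - grad F (iterate t)))\<^sup>2)
          + (\<Sum>t<T. (norm (grad F (iterate t)))\<^sup>2))"
  unfolding noise_factor_def
  using preconditioned_momentum_bound[where F = F and x = "\<lambda>t. iterate t" and m = "\<lambda>t. momentum t"
      and g = "\<lambda>t. sam_grad z t" and s = "\<lambda>t. batch_grad z t" and h = "\<lambda>t. preconditioner (state z t)",
      OF smoothness[unfolded smoothness_def, THEN conjunct2, THEN conjunct2] L_pos
        abs_grad_objective_nth_le G_pos lower_bound \<beta>\<^sub>1_bounds \<gamma>_pos \<epsilon>_bounds(1) \<rho>_nonneg _
        momentum_Suc abs_sam_grad_nth_le preconditioner_nonneg preconditioner_bounds(2)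
        preconditioner_decreasing iterate_Suc sam_grad_perturbation, of T]
  by simp

end

section \<open>Expectations over the random mini-batches\<close>

context
  fixes M :: "'w measure" and X :: "nat \<Rightarrow> nat \<Rightarrow> 'w \<Rightarrow> 'z"
  assumes iid: "iid_minibatches M D b X"
begin

interpretation M: prob_space M
  using iid by (simp add: iid_minibatches_def)

abbreviation "random_state t \<omega> \<equiv> state (\<lambda>t i. X t i \<omega>) t"
abbreviation "batch t \<omega> \<equiv> \<lambda>i\<in>{..<b}. X t i \<omega>"

lemma indep_samples: "M.indep_vars (\<lambda>_. D) (\<lambda>(t, i). X t i) (UNIV \<times> {..<b})"
  using iid by (simp add: iid_minibatches_def)

lemma measurable_sample:
  assumes "i < b"
  shows "X t i \<in> measurable M D"
  using indep_samples assms unfolding M.indep_vars_def2 by auto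

lemma sample_in_space:
  assumes "\<omega> \<in> space M" and "i < b"
  shows "X t i \<omega> \<in> space D"
  using measurable_space[OF measurable_sample] assms by simp

lemma measurable_batch [measurable]: "batch t \<in> measurable M (batches b)"
  by (rule measurable_restrict) (simp add: measurable_sample)

lemma measurable_random_state [measurable]: "random_state t \<in> borel_measurable M"
  by (rule borel_measurable_adasam_state) (rule measurable_batch)

text \<open>All samples together have a product law; a mini-batch is its marginal on the indices
  with first component \<open>t\<close>, reindexed by the second.\<close>

lemma distr_batch: "distr M (batches b) (batch t) = batches b"
proof -
  let ?I = "UNIV \<times> {..<b} :: (nat \<times> nat) set" and ?Y = "\<lambda>\<omega>. \<lambda>p\<in>UNIV \<times> {..<b}. (case p of (t, i) \<Rightarrow> X t i) \<omega>"
  have "?I \<noteq> {}" using b_pos by (auto simp: lessThan_empty_iff)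
  then have "distr M (PiM ?I (\<lambda>_. D)) ?Y = PiM ?I (\<lambda>p. distr M D (case p of (t, i) \<Rightarrow> X t i))"
    using indep_samples M.indep_vars_iff_distr_eq_PiM'[of ?I "\<lambda>(t, i). X t i" "\<lambda>_. D"]
    by (force simp: measurable_sample)
  also have "\<dots> = PiM ?I (\<lambda>_. D)"
    using iid by (intro PiM_cong) (auto simp: iid_minibatches_def)
  finally have Y: "distr M (PiM ?I (\<lambda>_. D)) ?Y = PiM ?I (\<lambda>_. D)" .
  have "batches b = distr (PiM ?I (\<lambda>_. D)) (batches b) (\<lambda>w. \<lambda>i\<in>{..<b}. w (t, i))"
    using distr_PiM_reindex[of ?I "\<lambda>_. D" "\<lambda>i. (t, i)" "{..<b}"] D.prob_space_axioms
    by (simp add: inj_on_def)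
  also have "\<dots> = distr (distr M (PiM ?I (\<lambda>_. D)) ?Y) (batches b) (\<lambda>w. \<lambda>i\<in>{..<b}. w (t, i))"
    by (simp only: Y)
  also have "\<dots> = distr M (batches b) ((\<lambda>w. \<lambda>i\<in>{..<b}. w (t, i)) \<circ> ?Y)"
    by (intro distr_distr measurable_restrict) (auto simp: measurable_sample)
  also have "(\<lambda>w. \<lambda>i\<in>{..<b}. w (t, i)) \<circ> ?Y = batch t"
    by (auto simp: fun_eq_iff)
  finally show ?thesis ..
qed

text \<open>State and fresh mini-batch are functions of the samples over the disjoint index sets
  \<open>?A\<close> and \<open>?B\<close>.\<close>

lemma joint_distr_state_batch:
  "distr M borel (random_state t) \<Otimes>\<^sub>M distr M (batches b) (batch t)
    = distr M (borel \<Otimes>\<^sub>M batches b) (\<lambda>\<omega>. (random_state t \<omega>, batch t \<omega>))"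
proof -
  let ?A = "{..<t} \<times> {..<b}" and ?B = "{t} \<times> {..<b}"
  let ?R = "\<lambda>I \<omega>. \<lambda>p\<in>I. (case p of (t, i) \<Rightarrow> X t i) \<omega>"
  let ?\<phi> = "\<lambda>w. state (\<lambda>s i. w (s, i)) t" and ?\<psi> = "\<lambda>w. \<lambda>i\<in>{..<b}. w (t, i)"
  have "M.indep_var (PiM ?A (\<lambda>_. D)) (?R ?A) (PiM ?B (\<lambda>_. D)) (?R ?B)"
    by (rule M.indep_var_restrict[OF indep_samples]) auto
  moreover have "?\<phi> \<in> measurable (PiM ?A (\<lambda>_. D)) borel"
    by (rule borel_measurable_adasam_state) (auto intro!: measurable_restrict)
  moreover have "?\<psi> \<in> measurable (PiM ?B (\<lambda>_. D)) (batches b)"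
    by (auto intro!: measurable_restrict)
  ultimately have "distr M borel (\<lambda>\<omega>. ?\<phi> (?R ?A \<omega>)) \<Otimes>\<^sub>M distr M (batches b) (\<lambda>\<omega>. ?\<psi> (?R ?B \<omega>))
      = distr M (borel \<Otimes>\<^sub>M batches b) (\<lambda>\<omega>. (?\<phi> (?R ?A \<omega>), ?\<psi> (?R ?B \<omega>)))"
    by (rule M.indep_var_joint_distr)
  moreover have "?\<phi> (?R ?A \<omega>) = random_state t \<omega>" for \<omega>
    by (rule adasam_state_cong) simp
  moreover have "?\<psi> (?R ?B \<omega>) = batch t \<omega>" for \<omega>
    by (simp add: fun_eq_iff)
  ultimately show ?thesis by simp
qed

text \<open>Expectations may be computed by integrating the fresh mini-batch over
  \<open>batches b\<close> with the state fixed.\<close>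

lemmas integral_state_batch = M.integral_independent[OF measurable_random_state measurable_batch
    joint_distr_state_batch, unfolded distr_batch]

lemma measurable_integrands:
  "(\<lambda>(p, z). grad F (fst p) \<bullet> (minibatch_grad f b z (fst p) * preconditioner p))
    \<in> borel_measurable (borel \<Otimes>\<^sub>M batches b)"
  "(\<lambda>(p, z). (norm (minibatch_grad f b z (fst p) - grad F (fst p)))\<^sup>2)
    \<in> borel_measurable (borel \<Otimes>\<^sub>M batches b)"
  unfolding inner_mult_vec case_prod_unfold by measurable

lemma batch_grad_eq:
  "batch_grad (\<lambda>t i. X t i \<omega>) t = minibatch_grad f b (batch t \<omega>) (fst (random_state t \<omega>))"
  unfolding batch_grad_def by (rule fun_cong[OF minibatch_grad_cong]) simp

lemma expected_sq_grad_bounds: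
  fixes t :: nat
  defines "N \<equiv> \<lambda>\<omega>. (norm (grad F (fst (random_state t \<omega>))))\<^sup>2"
  shows "integrable M N" and "(\<integral>\<omega>. N \<omega> \<partial>M) \<le> real CARD('n) * G\<^sup>2"
proof -
  have "0 \<le> N \<omega>" "N \<omega> \<le> real CARD('n) * G\<^sup>2" for \<omega>
    unfolding N_def by (auto intro!: norm_sq_le_card abs_grad_objective_nth_le)
  moreover have "N \<in> borel_measurable M"
    unfolding N_def by measurable
  ultimately show int: "integrable M N"
    by (intro M.integrable_const_bound[where B = "real CARD('n) * G\<^sup>2"]) auto
  then show "(\<integral>\<omega>. N \<omega> \<partial>M) \<le> real CARD('n) * G\<^sup>2"
    using \<open>\<And>\<omega>. N \<omega> \<le> _\<close> by (intro M.integral_le_const) auto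
qed

text \<open>With the state fixed, averaging over the mini-batch turns \<open>batch_grad\<close> into
  the true gradient, and the entries of the preconditioner are at least \<open>1 / G\<close>.
  Boundedness gives the integrability for Fubini.\<close>

lemma expected_inner_batch_grad:
  fixes t :: nat
  defines "U \<equiv> \<lambda>\<omega>. grad F (fst (random_state t \<omega>)) \<bullet>
    (batch_grad (\<lambda>t i. X t i \<omega>) t * preconditioner (random_state t \<omega>))"
  shows "integrable M U"
    and "(\<integral>\<omega>. (norm (grad F (fst (random_state t \<omega>))))\<^sup>2 \<partial>M) / G \<le> (\<integral>\<omega>. U \<omega> \<partial>M)"
proof -
  let ?h = "\<lambda>(p, z). grad F (fst p) \<bullet> (minibatch_grad f b z (fst p) * preconditioner p)"
  let ?I = "\<lambda>p. grad F (fst p) \<bullet> (grad F (fst p) * preconditioner p)"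
  have U: "U = (\<lambda>\<omega>. ?h (random_state t \<omega>, batch t \<omega>))"
    unfolding U_def batch_grad_eq by simp
  have "\<bar>U \<omega>\<bar> \<le> G\<^sup>2 * (\<Sum>i\<in>(UNIV::'n set). 1 / \<epsilon>)" if "\<omega> \<in> space M" for \<omega>
    unfolding U_def batch_grad_def
    using that b_pos preconditioner_bounds(2) preconditioner_nonneg sample_in_space
    by (intro abs_inner_mult_le abs_grad_objective_nth_le abs_minibatch_grad_nth_le)
      (auto simp: abs_le_iff intro: order_trans[OF _ preconditioner_nonneg])
  moreover have "U \<in> borel_measurable M"
    unfolding U by (rule measurable_compose[OF _ measurable_integrands(1)]) measurable
  ultimately show int: "integrable M U"
    by (intro M.integrable_const_bound[where B = "G\<^sup>2 * (\<Sum>i\<in>(UNIV::'n set). 1 / \<epsilon>)"] AE_I2) auto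
  \<comment> \<open>The preconditioner is moved to the other factor of the inner product, so that
    the integral acts on the mini-batch gradient alone.\<close>
  have inner: "(\<integral>z. ?h (p, z) \<partial>batches b) = ?I p" for p
  proof -
    have "(\<integral>z. (grad F (fst p) * preconditioner p) \<bullet> minibatch_grad f b z (fst p) \<partial>batches b)
        = (grad F (fst p) * preconditioner p) \<bullet> grad F (fst p)"
      using has_bochner_integral_minibatch_grad[OF b_pos, of "fst p"]
      by (simp add: has_bochner_integral_iff)
    then show ?thesis
      by (simp add: inner_vec_def mult_ac)
  qed
  note fubini = integral_state_batch[OF measurable_integrands(1), of t, unfolded inner]
  have "(\<integral>\<omega>. (norm (grad F (fst (random_state t \<omega>))))\<^sup>2 \<partial>M) / G
      = (\<integral>\<omega>. (norm (grad F (fst (random_state t \<omega>))))\<^sup>2 / G \<partial>M)"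
    by simp
  also have "\<dots> \<le> (\<integral>\<omega>. ?I (random_state t \<omega>) \<partial>M)"
  proof (rule integral_mono)
    show "integrable M (\<lambda>\<omega>. (norm (grad F (fst (random_state t \<omega>))))\<^sup>2 / G)"
      using expected_sq_grad_bounds(1) by simp
    show "integrable M (\<lambda>\<omega>. ?I (random_state t \<omega>))"
      using fubini(1) int unfolding U by simp
    fix \<omega> assume \<omega>: "\<omega> \<in> space M"
    let ?u = "grad F (fst (random_state t \<omega>))"
    have "(norm ?u)\<^sup>2 / G = (\<Sum>i\<in>UNIV. (?u $ i)\<^sup>2 * (1 / G))"
      by (simp add: norm_vec_def L2_set_def sum_nonneg sum_divide_distrib)
    also have "\<dots> \<le> (\<Sum>i\<in>UNIV. (?u $ i)\<^sup>2 * preconditioner (random_state t \<omega>) $ i)"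
      using \<omega> sample_in_space by (intro sum_mono mult_left_mono preconditioner_bounds(1)) auto
    finally show "(norm ?u)\<^sup>2 / G \<le> ?I (random_state t \<omega>)"
      by (simp add: inner_mult_vec power2_eq_square)
  qed
  also have "\<dots> = (\<integral>\<omega>. U \<omega> \<partial>M)"
    using fubini(2) int unfolding U by simp
  finally show "(\<integral>\<omega>. (norm (grad F (fst (random_state t \<omega>))))\<^sup>2 \<partial>M) / G \<le> (\<integral>\<omega>. U \<omega> \<partial>M)" .
qed

text \<open>The variance assumption holds at every fixed point, hence with the state frozen, and
  then on average over states.\<close>

lemma expected_batch_variance:
  fixes t :: nat
  defines "V \<equiv> \<lambda>\<omega>. (norm (batch_grad (\<lambda>t i. X t i \<omega>) t - grad F (fst (random_state t \<omega>))))\<^sup>2"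
  shows "integrable M V" and "(\<integral>\<omega>. V \<omega> \<partial>M) \<le> \<sigma>\<^sup>2 / real b"
proof -
  let ?h = "\<lambda>(p, z). (norm (minibatch_grad f b z (fst p) - grad F (fst p)))\<^sup>2"
  have V: "V = (\<lambda>\<omega>. ?h (random_state t \<omega>, batch t \<omega>))"
    unfolding V_def batch_grad_eq by simp
  have "\<bar>V \<omega>\<bar> \<le> real CARD('n) * (2 * G)\<^sup>2" if "\<omega> \<in> space M" for \<omega>
  proof -
    have "\<bar>(batch_grad (\<lambda>t i. X t i \<omega>) t - grad F (fst (random_state t \<omega>))) $ i\<bar> \<le> 2 * G" for i
      using abs_minibatch_grad_nth_le[of b "\<lambda>i. X t i \<omega>" "fst (random_state t \<omega>)" i]
        b_pos sample_in_space[OF that] abs_grad_objective_nth_le[of "fst (random_state t \<omega>)" i]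
      unfolding batch_grad_def by simp
    from norm_sq_le_card[OF this] show ?thesis
      by (simp only: V_def abs_of_nonneg[OF zero_le_power2])
  qed
  moreover have "V \<in> borel_measurable M"
    unfolding V by (rule measurable_compose[OF _ measurable_integrands(2)]) measurable
  ultimately show int: "integrable M V"
    by (intro M.integrable_const_bound[where B = "real CARD('n) * (2 * G)\<^sup>2"] AE_I2) auto
  note fubini = integral_state_batch[OF measurable_integrands(2), of t]
  have "(\<integral>z. ?h (p, z) \<partial>batches b) \<le> \<sigma>\<^sup>2 / real b" for p
    using variance b_pos by (simp add: bounded_variance_def)
  then have "(\<integral>\<omega>. (\<integral>z. ?h (random_state t \<omega>, z) \<partial>batches b) \<partial>M) \<le> \<sigma>\<^sup>2 / real b"
    using fubini(1) int unfolding V by (intro M.integral_le_const) auto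
  then show "(\<integral>\<omega>. V \<omega> \<partial>M) \<le> \<sigma>\<^sup>2 / real b"
    using fubini(2) int unfolding V by simp
qed

text \<open>The path bound in expectation, divided by \<open>T\<close>. \<open>N\<close> recurs on
  the right with half its left coefficient and with a multiple of \<open>\<gamma>\<close>, so small
  \<open>\<gamma>\<close> lets it be absorbed; the crude first bound covers the remaining
  \<open>\<gamma>\<close>.\<close>

lemma mean_sq_grad_recursion:
  assumes "1 \<le> T"
  defines "N \<equiv> mean_sq_grad M X D f x0 b \<gamma> \<rho> \<beta>\<^sub>1 \<beta>\<^sub>2 \<epsilon> T"
  shows "N \<le> real CARD('n) * G\<^sup>2"
    and "N / G \<le> (F x0 - fstar) / (\<gamma> * real T)
      + (1 + 2 / (1 - \<beta>\<^sub>1)) * (real CARD('n) * G\<^sup>2 / \<epsilon>) / real T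
      + N / (2 * G) + G * L\<^sup>2 * \<rho>\<^sup>2 / (2 * \<epsilon>\<^sup>2)
      + noise_factor * \<gamma> * (L\<^sup>2 * \<rho>\<^sup>2 + \<sigma>\<^sup>2 / real b + N)"
proof -
  let ?N = "\<lambda>t \<omega>. (norm (grad F (fst (random_state t \<omega>))))\<^sup>2"
  let ?V = "\<lambda>t \<omega>. (norm (batch_grad (\<lambda>t i. X t i \<omega>) t - grad F (fst (random_state t \<omega>))))\<^sup>2"
  let ?U = "\<lambda>t \<omega>. grad F (fst (random_state t \<omega>)) \<bullet>
    (batch_grad (\<lambda>t i. X t i \<omega>) t * preconditioner (random_state t \<omega>))"
  define S where "S = (\<Sum>t<T. \<integral>\<omega>. ?N t \<omega> \<partial>M)"
  have N: "N = S / real T"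
    by (simp add: N_def S_def mean_sq_grad_def adasam_def)
  have "S \<le> (\<Sum>t<T. real CARD('n) * G\<^sup>2)"
    unfolding S_def by (intro sum_mono expected_sq_grad_bounds(2))
  then show "N \<le> real CARD('n) * G\<^sup>2"
    using \<open>1 \<le> T\<close> by (simp add: N field_simps)
  define a where "a = (F x0 - fstar) / \<gamma> + (1 + 2 / (1 - \<beta>\<^sub>1)) * (real CARD('n) * G\<^sup>2 / \<epsilon>)
    + real T * (G * L\<^sup>2 * \<rho>\<^sup>2 / (2 * \<epsilon>\<^sup>2)) + noise_factor * \<gamma> * (real T * (L\<^sup>2 * \<rho>\<^sup>2))"
  define c where "c = noise_factor * \<gamma>"
  have c: "0 \<le> c" using noise_factor_pos \<gamma>_pos by (simp add: c_def)
  have intN: "integrable M (?N t)" and intV: "integrable M (?V t)" and intU: "integrable M (?U t)" for t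
    by (rule expected_sq_grad_bounds(1) expected_batch_variance(1) expected_inner_batch_grad(1))+
  have "S / G \<le> (\<Sum>t<T. \<integral>\<omega>. ?U t \<omega> \<partial>M)"
    unfolding S_def sum_divide_distrib by (intro sum_mono expected_inner_batch_grad(2))
  also have "\<dots> = (\<integral>\<omega>. (\<Sum>t<T. ?U t \<omega>) \<partial>M)"
    using intU by simp
  also have "\<dots> \<le> (\<integral>\<omega>. (a + (1 / (2 * G) + c) * (\<Sum>t<T. ?N t \<omega>)) + c * (\<Sum>t<T. ?V t \<omega>) \<partial>M)"
  proof (rule integral_mono)
    fix \<omega> assume "\<omega> \<in> space M"
    then show "(\<Sum>t<T. ?U t \<omega>) \<le> (a + (1 / (2 * G) + c) * (\<Sum>t<T. ?N t \<omega>)) + c * (\<Sum>t<T. ?V t \<omega>)"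
      using path_bound[of "\<lambda>t i. X t i \<omega>" T] sample_in_space
      by (simp add: a_def c_def algebra_simps)
  qed (use intN intV intU in auto)
  also have "\<dots> = a + (1 / (2 * G) + c) * S + c * (\<Sum>t<T. \<integral>\<omega>. ?V t \<omega> \<partial>M)"
    using intN intV by (simp add: S_def M.prob_space)
  also have "\<dots> \<le> a + (1 / (2 * G) + c) * S + c * (\<Sum>t<T. \<sigma>\<^sup>2 / real b)"
    using c by (intro add_left_mono mult_left_mono sum_mono expected_batch_variance(2)) auto
  finally have "S / G / real T \<le> (a + (1 / (2 * G) + c) * S + c * (real T * (\<sigma>\<^sup>2 / real b))) / real T"
    using \<open>1 \<le> T\<close> by (intro divide_right_mono) auto
  also have "\<dots> = (F x0 - fstar) / (\<gamma> * real T)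
      + (1 + 2 / (1 - \<beta>\<^sub>1)) * (real CARD('n) * G\<^sup>2 / \<epsilon>) / real T
      + N / (2 * G) + G * L\<^sup>2 * \<rho>\<^sup>2 / (2 * \<epsilon>\<^sup>2) + c * (L\<^sup>2 * \<rho>\<^sup>2 + \<sigma>\<^sup>2 / real b + N)"
    using \<open>1 \<le> T\<close> unfolding a_def N c_def[symmetric]
    by (simp add: add_divide_distrib distrib_left distrib_right)
  finally show "N / G \<le> (F x0 - fstar) / (\<gamma> * real T)
      + (1 + 2 / (1 - \<beta>\<^sub>1)) * (real CARD('n) * G\<^sup>2 / \<epsilon>) / real T
      + N / (2 * G) + G * L\<^sup>2 * \<rho>\<^sup>2 / (2 * \<epsilon>\<^sup>2)
      + noise_factor * \<gamma> * (L\<^sup>2 * \<rho>\<^sup>2 + \<sigma>\<^sup>2 / real b + N)"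
    by (simp add: c_def N mult.commute)
qed

end

end

section \<open>Convergence rate\<close>

text \<open>For \<open>\<gamma>\<close> of order \<open>sqrt (b / T)\<close>, these give the order
  of \<open>\<gamma> / b\<close> and of \<open>1 / (\<gamma> * T)\<close>.\<close>

lemma sqrt_ratio_identities:
  fixes b T :: real
  assumes "0 < b" and "0 < T"
  shows "sqrt (b / T) / b = 1 / sqrt (b * T)" and "sqrt (b / T) * T = sqrt (b * T)"
proof -
  have [simp]: "sqrt b * sqrt b = b" "sqrt T * sqrt T = T"
    using assms by auto
  show "sqrt (b / T) / b = 1 / sqrt (b * T)" "sqrt (b / T) * T = sqrt (b * T)"
    using assms by (simp_all add: real_sqrt_divide real_sqrt_mult field_simps)
qed

text \<open>After multiplication by \<open>4 * G\<close> the left side is \<open>4 * N\<close>; the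
  right side returns \<open>2 * N\<close> from the halved term and at most \<open>N\<close> from the
  last one, leaving one \<open>N\<close>.\<close>

lemma absorb_recursion:
  fixes N :: real
  assumes "0 < G" and "0 \<le> N" and rate: "4 * G * (c * \<gamma>) \<le> 1"
    and rec: "N / G \<le> a + k + N / (2 * G) + p * r + c * \<gamma> * (L * r + s + N)" and "0 \<le> L * r"
  shows "N \<le> 4 * G * (a + k) + (4 * G * p + L) * r + 4 * G * (c * \<gamma> * s)"
proof -
  have "4 * G * (N / G) \<le> 4 * G * (a + k + N / (2 * G) + p * r + c * \<gamma> * (L * r + s + N))"
    using rec \<open>0 < G\<close> by (intro mult_left_mono) auto
  also have "\<dots> = 4 * G * (a + k) + 2 * N + 4 * G * p * r + 4 * G * (c * \<gamma> * s)
      + 4 * G * (c * \<gamma>) * (L * r + N)"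
    using \<open>0 < G\<close> by (simp add: field_simps)
  also have "4 * G * (c * \<gamma>) * (L * r + N) \<le> 1 * (L * r + N)"
    using rate assms by (intro mult_right_mono) auto
  finally show ?thesis
    using \<open>0 < G\<close> by (simp add: algebra_simps)
qed

text \<open>The constants are fixed before \<open>b\<close>, \<open>T\<close>, the step parameters
  and the probability space, so the bound is uniform in these.\<close>

lemma mean_sq_grad_rate:
  fixes D :: "'z measure" and f :: "'z \<Rightarrow> real ^ 'n \<Rightarrow> real" and x0 :: "real ^ 'n"
  assumes "prob_space D"
    and smooth: "smoothness D f L"
    and var: "bounded_variance D f \<sigma>"
    and bnd: "bounded_stochastic_gradients D f G"
    and lower: "\<And>x. fstar \<le> objective D f x"
    and \<epsilon>: "0 < \<epsilon>" "\<epsilon> \<le> G"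
    and \<beta>\<^sub>1: "0 \<le> \<beta>\<^sub>1" "\<beta>\<^sub>1 < 1" and \<beta>\<^sub>2: "0 \<le> \<beta>\<^sub>2" "\<beta>\<^sub>2 \<le> 1"
    and "0 < c1" and "0 < c2"
  obtains K1 K2 K3 K4 where "0 \<le> K1" "0 \<le> K2" "0 \<le> K3" "0 \<le> K4"
    "\<And>b T \<gamma> \<rho> (M :: 'w measure) X. 1 \<le> b \<Longrightarrow> 1 \<le> T \<Longrightarrow>
      admissible_parameters c1 c2 c3 \<epsilon> L b T \<gamma> \<rho> \<Longrightarrow> iid_minibatches M D b X \<Longrightarrow>
      mean_sq_grad M X D f x0 b \<gamma> \<rho> \<beta>\<^sub>1 \<beta>\<^sub>2 \<epsilon> T
        \<le> K1 * (1 / sqrt (real b * real T)) + K2 * (1 / (real b * real T))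
          + K3 * (1 / real T) + K4 * (real b / real T)"
proof -
  define W where "W = objective D f x0 - fstar"
  define d where "d = real CARD('n) * G\<^sup>2"
  define k where "k = (1 + 2 / (1 - \<beta>\<^sub>1)) * (d / \<epsilon>)"
  define p where "p = G * L\<^sup>2 / (2 * \<epsilon>\<^sup>2)"
  define c where "c = 3 * L * (1 + 1 / (1 - \<beta>\<^sub>1)) / \<epsilon>\<^sup>2"
  have pos: "0 < G" "0 \<le> W" "0 \<le> d" "0 < L" "0 < \<epsilon>"
    using \<epsilon> lower[of x0] smooth by (auto simp: W_def d_def smoothness_def)
  then have "0 \<le> k" "0 \<le> p" "0 < c"
    using \<beta>\<^sub>1 by (auto simp: k_def p_def c_def add_pos_nonneg)
  note pos = this pos
  \<comment> \<open>The lower bound on \<open>\<gamma>\<close> gives the part with the initial gap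
    \<open>W\<close>, the upper bound the part with the variance.\<close>
  define K1 where "K1 = 4 * G * (W / c1) + 4 * G * c * c2 * \<sigma>\<^sup>2"
  define K2 where "K2 = (4 * G * p + L\<^sup>2) * c3\<^sup>2"
  define K3 where "K3 = 4 * G * k"
  define K4 where "K4 = d * (4 * G * c * c2)\<^sup>2"
  have K: "0 \<le> K1" "0 \<le> K2" "0 \<le> K3" "0 \<le> K4"
    using pos \<open>0 < c1\<close> \<open>0 < c2\<close> by (auto simp: K1_def K2_def K3_def K4_def)
  show thesis
  proof (rule that[OF K])
    fix b T :: nat and \<gamma> \<rho> :: real and M :: "'w measure" and X :: "nat \<Rightarrow> nat \<Rightarrow> 'w \<Rightarrow> 'z"
    assume bT: "1 \<le> b" "1 \<le> T" and adm: "admissible_parameters c1 c2 c3 \<epsilon> L b T \<gamma> \<rho>"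
      and iid: "iid_minibatches M D b X"
    let ?N = "mean_sq_grad M X D f x0 b \<gamma> \<rho> \<beta>\<^sub>1 \<beta>\<^sub>2 \<epsilon> T"
    let ?q = "sqrt (real b / real T)" and ?r = "1 / sqrt (real b * real T)"
    have q: "0 < ?q" using bT by simp
    have \<gamma>: "c1 * ?q \<le> \<gamma>" "\<gamma> \<le> c2 * ?q" and \<rho>: "0 \<le> \<rho>" "\<rho> \<le> c3 * sqrt (1 / (real b * real T))"
      using adm by (auto simp: admissible_parameters_def)
    have \<gamma>_pos: "0 < \<gamma>"
      using \<gamma>(1) q \<open>0 < c1\<close> by (meson less_le_trans mult_pos_pos)
    interpret prob_space D by fact
    interpret adasam_setup D f L \<sigma> G x0 b \<gamma> \<rho> \<beta>\<^sub>1 \<beta>\<^sub>2 \<epsilon> fstar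
      using smooth var bnd lower pos \<epsilon> \<beta>\<^sub>1 \<beta>\<^sub>2 bT \<gamma>_pos \<rho> by unfold_locales auto
    have N_le: "?N \<le> d"
      using mean_sq_grad_recursion(1)[OF iid bT(2)] by (simp add: d_def)
    have N_nonneg: "0 \<le> ?N"
      by (simp add: mean_sq_grad_def sum_nonneg)
    show "?N \<le> K1 * ?r + K2 * (1 / (real b * real T)) + K3 * (1 / real T) + K4 * (real b / real T)"
    \<comment> \<open>The threshold under which the \<open>\<gamma>\<close> multiple of
      \<open>?N\<close> can be absorbed.\<close>
    proof (cases "4 * G * (c * \<gamma>) \<le> 1")
      case True
      have "?N / G \<le> W / (\<gamma> * real T) + k / real T + ?N / (2 * G) + p * \<rho>\<^sup>2
          + c * \<gamma> * (L\<^sup>2 * \<rho>\<^sup>2 + \<sigma>\<^sup>2 / real b + ?N)"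
        using mean_sq_grad_recursion(2)[OF iid bT(2)]
        by (simp add: W_def k_def d_def p_def c_def noise_factor_def)
      from absorb_recursion[OF \<open>0 < G\<close> N_nonneg True this]
      have N_bound: "?N \<le> 4 * G * (W / (\<gamma> * real T) + k / real T) + (4 * G * p + L\<^sup>2) * \<rho>\<^sup>2
          + 4 * G * (c * \<gamma> * (\<sigma>\<^sup>2 / real b))"
        by simp
      have W_le: "W / (\<gamma> * real T) \<le> W / c1 * ?r"
      proof -
        have "c1 * sqrt (real b * real T) \<le> \<gamma> * real T"
          using mult_right_mono[OF \<gamma>(1), of "real T"] sqrt_ratio_identities(2)[of b T] bT
          by (simp add: mult.assoc)
        then have "W / (\<gamma> * real T) \<le> W / (c1 * sqrt (real b * real T))"
          using pos bT \<open>0 < c1\<close> \<gamma>_pos by (intro divide_left_mono) auto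
        then show ?thesis by simp
      qed
      have \<rho>_le: "\<rho>\<^sup>2 \<le> c3\<^sup>2 * (1 / (real b * real T))"
        using power_mono[OF \<rho>(2,1), of 2] by (simp add: power_mult_distrib real_sqrt_pow2)
      have \<sigma>_le: "c * \<gamma> * (\<sigma>\<^sup>2 / real b) \<le> c * c2 * \<sigma>\<^sup>2 * ?r"
      proof -
        have "\<gamma> / real b \<le> c2 * (?q / real b)"
          using divide_right_mono[OF \<gamma>(2), of "real b"] by simp
        also have "?q / real b = ?r"
          using sqrt_ratio_identities(1)[of b T] bT by simp
        finally have "c * \<sigma>\<^sup>2 * (\<gamma> / real b) \<le> c * \<sigma>\<^sup>2 * (c2 * ?r)"
          using pos by (intro mult_left_mono) auto
        then show ?thesis by (simp add: mult_ac)
      qed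
      have "?N \<le> 4 * G * (W / c1 * ?r + k / real T)
          + (4 * G * p + L\<^sup>2) * (c3\<^sup>2 * (1 / (real b * real T)))
          + 4 * G * (c * c2 * \<sigma>\<^sup>2 * ?r)"
        using pos by (intro order_trans[OF N_bound] add_mono mult_left_mono W_le \<rho>_le \<sigma>_le order_refl) auto
      also have "\<dots> = K1 * ?r + K2 * (1 / (real b * real T)) + K3 * (1 / real T)"
        by (simp add: K1_def K2_def K3_def algebra_simps)
      finally have "?N \<le> K1 * ?r + K2 * (1 / (real b * real T)) + K3 * (1 / real T)" .
      then show ?thesis using K by (smt (verit) divide_nonneg_nonneg mult_nonneg_nonneg of_nat_0_le_iff)
    next
      case False
      \<comment> \<open>A large \<open>\<gamma>\<close> bounds \<open>b / T\<close> from below, so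
        the constant bound \<open>d\<close> is itself of order \<open>b / T\<close>. Squaring turns
        the root into this ratio.\<close>
      then have "1 \<le> 4 * G * (c * \<gamma>)" by simp
      also have "\<dots> \<le> 4 * G * c * c2 * ?q"
        using \<gamma>(2) pos by (simp add: mult.assoc mult_left_mono)
      finally have "1 \<le> (4 * G * c * c2 * ?q)\<^sup>2"
        by (simp add: one_le_power)
      then have "d * 1 \<le> d * (4 * G * c * c2 * ?q)\<^sup>2"
        using pos by (intro mult_left_mono) auto
      then have "d \<le> K4 * (real b / real T)"
        by (simp add: K4_def power_mult_distrib)
      with N_le have "?N \<le> K4 * (real b / real T)" by simp
      then show ?thesis using K by (smt (verit) divide_nonneg_nonneg mult_nonneg_nonneg of_nat_0_le_iff real_sqrt_ge_zero)
    qed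
  qed
qed

theorem corollary1:
  fixes D :: "'z measure"
    and f :: "'z \<Rightarrow> real ^ 'n \<Rightarrow> real"
    and x0 :: "real ^ 'n"
    and L \<sigma> G \<epsilon> \<beta>\<^sub>1 \<beta>\<^sub>2 fstar c1 c2 c3 :: real
  assumes "prob_space D"
    and "\<And>x. integrable D (\<lambda>\<xi>. f \<xi> x)"
    and "smoothness D f L"
    and "bounded_variance D f \<sigma>"
    and "bounded_stochastic_gradients D f G"
    and "fstar \<in> range (objective D f)" and "\<And>x. fstar \<le> objective D f x"
    and "0 < \<epsilon>" and "\<epsilon> \<le> G"
    and "0 \<le> \<beta>\<^sub>1" and "\<beta>\<^sub>1 < 1"
    and "0 \<le> \<beta>\<^sub>2" and "\<beta>\<^sub>2 \<le> 1"
    and "0 < c1" and "0 < c2" and "0 < c3"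
  shows
    "(\<exists>C1 C2 C3 C4 C5 C6.
        \<forall>b\<ge>1. \<forall>T\<ge>1. \<forall>\<gamma> \<rho>. \<forall>(M :: 'w measure) X.
          admissible_parameters c1 c2 c3 \<epsilon> L b T \<gamma> \<rho> \<longrightarrow> iid_minibatches M D b X \<longrightarrow>
          mean_sq_grad M X D f x0 b \<gamma> \<rho> \<beta>\<^sub>1 \<beta>\<^sub>2 \<epsilon> T
            \<le> C1 * (1 / sqrt (real b * real T)) + C2 * (1 / (real b * real T)) + C3 * (1 / real T)
              + C4 * (1 / (real b powr (1/2) * real T powr (3/2)))
              + C5 * (real b powr (1/2) / real T powr (3/2)) + C6 * (real b / real T)) \<and>
     (\<exists>C. \<forall>b\<ge>1. \<exists>T0. \<forall>T\<ge>max 1 T0. \<forall>\<gamma> \<rho>. \<forall>(M :: 'w measure) X.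
          admissible_parameters c1 c2 c3 \<epsilon> L b T \<gamma> \<rho> \<longrightarrow> iid_minibatches M D b X \<longrightarrow>
          mean_sq_grad M X D f x0 b \<gamma> \<rho> \<beta>\<^sub>1 \<beta>\<^sub>2 \<epsilon> T
            \<le> C * (1 / sqrt (real b * real T)))"
proof -
  obtain K1 K2 K3 K4 where K: "0 \<le> K1" "0 \<le> K2" "0 \<le> K3" "0 \<le> K4"
    and rate: "\<And>b T \<gamma> \<rho> (M :: 'w measure) X. 1 \<le> b \<Longrightarrow> 1 \<le> T \<Longrightarrow>
      admissible_parameters c1 c2 c3 \<epsilon> L b T \<gamma> \<rho> \<Longrightarrow> iid_minibatches M D b X \<Longrightarrow>
      mean_sq_grad M X D f x0 b \<gamma> \<rho> \<beta>\<^sub>1 \<beta>\<^sub>2 \<epsilon> T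
        \<le> K1 * (1 / sqrt (real b * real T)) + K2 * (1 / (real b * real T))
          + K3 * (1 / real T) + K4 * (real b / real T)"
    using mean_sq_grad_rate[where ?'w = 'w and ?x0.0 = x0 and ?c3.0 = c3, OF assms(1,3,4,5,7-15)] by blast
  show ?thesis
  proof (intro conjI exI allI impI)
    fix b T :: nat and \<gamma> \<rho> :: real and M :: "'w measure" and X :: "nat \<Rightarrow> nat \<Rightarrow> 'w \<Rightarrow> 'z"
    assume "1 \<le> b" "1 \<le> T" "admissible_parameters c1 c2 c3 \<epsilon> L b T \<gamma> \<rho>" "iid_minibatches M D b X"
    \<comment> \<open>The remaining four terms already bound the mean, so both mixed terms get the
      coefficient 0.\<close>
    from rate[OF this] show "mean_sq_grad M X D f x0 b \<gamma> \<rho> \<beta>\<^sub>1 \<beta>\<^sub>2 \<epsilon> T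
      \<le> K1 * (1 / sqrt (real b * real T)) + K2 * (1 / (real b * real T)) + K3 * (1 / real T)
        + 0 * (1 / (real b powr (1/2) * real T powr (3/2)))
        + 0 * (real b powr (1/2) / real T powr (3/2)) + K4 * (real b / real T)"
      by simp
  next
    fix b T :: nat and \<gamma> \<rho> :: real and M :: "'w measure" and X :: "nat \<Rightarrow> nat \<Rightarrow> 'w \<Rightarrow> 'z"
    \<comment> \<open>The threshold \<open>b ^ 3\<close> arises from squaring: \<open>b / T\<close>
      is at most \<open>1 / sqrt (b * T)\<close> exactly when \<open>b ^ 3 \<le> T\<close>.\<close>
    assume b: "1 \<le> b" and T: "max 1 (b ^ 3) \<le> T"
      and par: "admissible_parameters c1 c2 c3 \<epsilon> L b T \<gamma> \<rho>" "iid_minibatches M D b X"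
    let ?r = "1 / sqrt (real b * real T)"
    have T1: "1 \<le> T" using T by simp
    have "real b ^ 3 \<le> real T"
      using T by (metis max.bounded_iff of_nat_le_iff of_nat_power)
    then have "real b ^ 3 * real T \<le> (real T)\<^sup>2"
      by (simp add: power2_eq_square mult_right_mono)
    moreover have "(real b * sqrt (real b * real T))\<^sup>2 = real b ^ 3 * real T"
      by (simp add: power_mult_distrib power2_eq_square power3_eq_cube)
    ultimately have "(real b * sqrt (real b * real T))\<^sup>2 \<le> (real T)\<^sup>2"
      by simp
    then have "real b * sqrt (real b * real T) \<le> real T"
      by (rule power2_le_imp_le) simp
    then have r: "real b / real T \<le> ?r"
      using b T1 by (simp add: field_simps)
    have "1 / real T \<le> real b / real T" "1 / (real b * real T) \<le> 1 / real T"
      using b T1 by (auto simp: field_simps)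
    with r have "1 / real T \<le> ?r" "1 / (real b * real T) \<le> ?r"
      by linarith+
    with r K have "K2 * (1 / (real b * real T)) \<le> K2 * ?r" "K3 * (1 / real T) \<le> K3 * ?r"
      "K4 * (real b / real T) \<le> K4 * ?r"
      by (auto intro!: mult_left_mono simp del: times_divide_eq_right)
    with rate[OF b T1 par] show "mean_sq_grad M X D f x0 b \<gamma> \<rho> \<beta>\<^sub>1 \<beta>\<^sub>2 \<epsilon> T \<le> (K1 + K2 + K3 + K4) * ?r"
      unfolding distrib_right by linarith
  qed
qed

end
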